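(* For $m\ge1$ and $n\ge0$, $$\sum_{k\ge0}(-q^{m-1})^{n-k}\,S^o_{\mathrm{CR}}[m,n,k]=[m-1]^n.$$
   Context: $[j]=1+q+\dots+q^{j-1}$ (so $[0]=0$); $[km]!_m=[m][2m]\cdots[km]$ (empty product $1$ for $k=0$). Let $\zeta_m=e^{2\pi i/m}$, $i^c=\zeta_m^c\mathbf e_i$ for $i\in[n]$ (colors mod $m$), $[n^m]=\{0\}\cup\{i^c:i\in[n],0\le c<m\}$, $zS=\{zs:s\in S\}$. A colored set partition of type $(m,n)$ is a set partition of $[n^m]$ into blocks $S_0,\dots,S_{km}$ with (i) $0\in S_0$ and if some $i^c\in S_0$ then all $i^d\in S_0$; (ii) for each $0\le l<k$, $S_{lm+1},\dots,S_{(l+1)m}$ are distinct and of the form $S,\zeta_mS,\dots,\zeta_m^{m-1}S$. For nonempty $S$, $\operatorname{minb}S=0$ if $0\in S$, else the least base in $S$. Standard form: blocks labeled so that (ii) holds, $s_i=\operatorname{minb}S_i$ satisfy $0=s_0<s_m<\dots<s_{km}$, and $s_j^{\,r}\in S_j$ for $j\in[km]$ with $r=j\bmod m$. An inversion is a pair $(i^0,S_l)$ with $i^0\in S_j$, $j<l$, $i\ge s_l$. $S[m,n,k]=\sum q^{\operatorname{inv}\sigma}$ over type $(m,n)$ colored set partitions with $km+1$ blocks, and $S^o_{\mathrm{CR}}[m,n,k]=[km]!_m\,S[m,n,k]$. *)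

theory Defs
  imports
    Complex_Main
    "HOL-Library.Disjoint_Sets"
    "HOL-Library.Groups_Big_Fun"
    "HOL-Computational_Algebra.Polynomial"
begin

section \<open>q-analogues\<close>

text \<open>All identities are polynomial identities in an indeterminate q with integer coefficients.\<close>

abbreviation q :: "int poly" where
  "q \<equiv> [:0, 1:]"

definition qnum :: "nat \<Rightarrow> int poly" where
  "qnum j = (\<Sum>i<j. q ^ i)"

definition qfact_step :: "nat \<Rightarrow> nat \<Rightarrow> int poly" where
  "qfact_step m k = (\<Prod>j=1..k. qnum (j * m))" \<comment> \<open>this is [km]!_m\<close>


section \<open>Colored set partitions\<close>

text \<open>Vectors over the complex numbers are coordinate functions; those in \<open>ground m n\<close> are
  supported on the coordinates 1, ..., n.\<close>

type_synonym cvec = "nat \<Rightarrow> complex"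

definition zeta :: "nat \<Rightarrow> complex" where
  "zeta m = cis (2 * pi / real m)"

definition zero_vec :: cvec where
  "zero_vec = (\<lambda>_. 0)"

text \<open>The colored number \<open>i^c\<close>, the vector \<open>zeta m ^ c\<close> times the i-th unit vector; it depends on
  c only modulo m.\<close>

definition colored :: "nat \<Rightarrow> nat \<Rightarrow> nat \<Rightarrow> cvec" where
  "colored m i c = (\<lambda>j. if j = i then zeta m ^ c else 0)"

definition ground :: "nat \<Rightarrow> nat \<Rightarrow> cvec set" where
  "ground m n = insert zero_vec {colored m i c | i c. i \<in> {1..n} \<and> c < m}"

definition scale :: "complex \<Rightarrow> cvec set \<Rightarrow> cvec set" where
  "scale z S = (\<lambda>s j. z * s j) ` S"

text \<open>A labelling of the partition \<open>\<sigma>\<close> lists its blocks as \<open>Ss ! 0, \<dots>, Ss ! (k * m)\<close>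
  subject to conditions (i) and (ii).\<close>

definition labelling :: "nat \<Rightarrow> nat \<Rightarrow> nat \<Rightarrow> cvec set set \<Rightarrow> cvec set list \<Rightarrow> bool" where
  "labelling m n k \<sigma> Ss \<longleftrightarrow>
     length Ss = k * m + 1 \<and> distinct Ss \<and> set Ss = \<sigma> \<and>
     zero_vec \<in> Ss ! 0 \<and>
     (\<forall>i\<in>{1..n}. (\<exists>c<m. colored m i c \<in> Ss ! 0) \<longrightarrow> (\<forall>d<m. colored m i d \<in> Ss ! 0)) \<and>
     (\<forall>l<k. \<exists>T. (!) Ss ` {l * m + 1..(l + 1) * m} = (\<lambda>c. scale (zeta m ^ c) T) ` {..<m})"

definition colored_partitions :: "nat \<Rightarrow> nat \<Rightarrow> nat \<Rightarrow> cvec set set set" where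
  "colored_partitions m n k =
     {\<sigma>. partition_on (ground m n) \<sigma> \<and> (\<exists>Ss. labelling m n k \<sigma> Ss)}"

definition minb :: "nat \<Rightarrow> cvec set \<Rightarrow> nat" where
  "minb m S = (if zero_vec \<in> S then 0 else (LEAST i. \<exists>c<m. colored m i c \<in> S))"

text \<open>Every colored set partition has exactly one labelling in standard form.  The condition on
  \<open>minb\<close> says 0 = s_0 < s_m < \<dots> < s_{km}.\<close>

definition standard_form :: "nat \<Rightarrow> nat \<Rightarrow> nat \<Rightarrow> cvec set set \<Rightarrow> cvec set list \<Rightarrow> bool" where
  "standard_form m n k \<sigma> Ss \<longleftrightarrow>
     labelling m n k \<sigma> Ss \<and>
     minb m (Ss ! 0) = 0 \<and>
     (\<forall>l<k. minb m (Ss ! (l * m)) < minb m (Ss ! ((l + 1) * m))) \<and>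
     (\<forall>j\<in>{1..k * m}. colored m (minb m (Ss ! j)) (j mod m) \<in> Ss ! j)"

definition the_standard_form :: "nat \<Rightarrow> nat \<Rightarrow> nat \<Rightarrow> cvec set set \<Rightarrow> cvec set list" where
  "the_standard_form m n k \<sigma> = (THE Ss. standard_form m n k \<sigma> Ss)"

definition inversions :: "nat \<Rightarrow> nat \<Rightarrow> cvec set list \<Rightarrow> (cvec \<times> cvec set) set" where
  "inversions m n Ss =
     {(colored m i 0, Ss ! l) | i j l.
        i \<in> {1..n} \<and> j < l \<and> l < length Ss \<and> colored m i 0 \<in> Ss ! j \<and> minb m (Ss ! l) \<le> i}"

definition inv_stat :: "nat \<Rightarrow> nat \<Rightarrow> nat \<Rightarrow> cvec set set \<Rightarrow> nat" where
  "inv_stat m n k \<sigma> = card (inversions m n (the_standard_form m n k \<sigma>))"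


section \<open>The q-Stirling numbers\<close>

definition S_CR :: "nat \<Rightarrow> nat \<Rightarrow> nat \<Rightarrow> int poly" where
  "S_CR m n k = (\<Sum>\<sigma>\<in>colored_partitions m n k. q ^ inv_stat m n k \<sigma>)"

definition So_CR :: "nat \<Rightarrow> nat \<Rightarrow> nat \<Rightarrow> int poly" where
  "So_CR m n k = qfact_step m k * S_CR m n k"

text \<open>The numbers vanish for k > n, so a sum over all k is finite and the truncated exponent
  n - k only matters for k at most n.\<close>

lemma finite_ground: "finite (ground m n)"
  and card_ground_le: "card (ground m n) \<le> Suc (n * m)"
proof -
  define A where "A = (\<lambda>(i, c). colored m i c) ` ({1..n} \<times> {..<m})"
  have ground: "ground m n = insert zero_vec A"
    unfolding ground_def A_def by (rule arg_cong[where f = "insert zero_vec"]) fast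
  have "finite A"
    unfolding A_def by simp
  moreover have "card A \<le> n * m"
    unfolding A_def by (rule order_trans[OF card_image_le]) auto
  ultimately show "finite (ground m n)" "card (ground m n) \<le> Suc (n * m)"
    unfolding ground by (auto simp: card_insert_if)
qed

lemma So_CR_eq_0:
  assumes "m \<ge> 1" "n < k"
  shows "So_CR m n k = 0"
proof -
  have False if \<sigma>: "\<sigma> \<in> colored_partitions m n k" for \<sigma>
  proof -
    from \<sigma> obtain Ss where P: "partition_on (ground m n) \<sigma>" and L: "labelling m n k \<sigma> Ss"
      by (auto simp: colored_partitions_def)
    have card: "card \<sigma> = Suc (k * m)"
      using L distinct_card[of Ss] by (auto simp: labelling_def)
    have ne: "(SOME x. x \<in> B) \<in> B" if "B \<in> \<sigma>" for B
      using partition_onD3[OF P] that by (metis ex_in_conv someI_ex)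
    have "inj_on (\<lambda>B. SOME x. x \<in> B) \<sigma>"
      using partition_onD2[OF P] ne by (intro inj_onI) (metis IntI disjointD empty_iff)
    moreover have "(\<lambda>B. SOME x. x \<in> B) ` \<sigma> \<subseteq> ground m n"
      using partition_onD1[OF P] ne by auto
    ultimately have "card \<sigma> \<le> card (ground m n)"
      using finite_ground by (rule card_inj_on_le)
    then have "k * m \<le> n * m"
      using card card_ground_le[of m n] by linarith
    then show False
      using assms by simp
  qed
  then have "colored_partitions m n k = {}"
    by blast
  then show ?thesis
    by (simp add: So_CR_def S_CR_def)
qed

end

theory Submission
  imports Defs "HOL-Number_Theory.Cong"
begin

text \<open>A colored set partition in standard form is determined by the word \<open>w\<close> whose letter
  \<open>w i\<close> is the index of the block containing \<open>i^0\<close>.  The words that occur are those of restricted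
  growth: each letter is at most \<open>k * m\<close> when \<open>k\<close> groups of blocks have been opened before, or
  equals \<open>Suc k * m\<close> and opens the next group.  Appending a letter \<open>j \<le> k * m\<close> creates \<open>k * m - j\<close>
  inversions and opening a group creates none, whence
  \<open>S[m,n+1,k] = S[m,n,k-1] + [km+1] S[m,n,k]\<close>.  The alternating sum then gains a factor
  \<open>[(k+1)m] - q^(m-1) [km+1] = [m-1]\<close> from \<open>n\<close> to \<open>n + 1\<close>.\<close>

section \<open>Rotation of labels\<close>

text \<open>The opening letter is the last label of its group because standard form puts the least
  base of block \<open>j\<close>, with color \<open>j mod m\<close>, into block \<open>j\<close>;
  within a group this color is 0 only for \<open>j = Suc l * m\<close>. The obstacle is that
  membership in \<open>colored_partitions\<close> supplies only some labelling, whose groups are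
  unordered sets listed in arbitrary order. Such a partition yields an arbitrary word compatible
  with rotation, and words are compared by \<open>keq\<close>, which sees only which points share a
  block. Among nonempty words with first letter 0, each class of \<open>keq\<close> contains exactly
  one restricted growth word. Uniqueness of the standard form is a separate matter, needed to
  evaluate the definite description: the color condition forces the order inside each group, the
  increasing least bases force the order of the groups.\<close>

text \<open>If \<open>i^0\<close> lies in block \<open>a\<close> of a standard form, then \<open>i^c\<close> lies in block \<open>rot m a c\<close>.\<close>

definition rot :: "nat \<Rightarrow> nat \<Rightarrow> nat \<Rightarrow> nat" where
  "rot m a c = (if a = 0 then 0 else (a - 1) div m * m + (a - 1 + c) mod m + 1)"

lemma rot_zero [simp]: "rot m 0 c = 0"
  by (simp add: rot_def)

text \<open>A positive label is position \<open>r\<close> in group \<open>l\<close>; the offset 1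
  makes room for the zero block, so group \<open>l\<close> ends at \<open>Suc l * m\<close>.\<close>

lemma label_cases:
  fixes m a :: nat
  assumes "0 < m"
  obtains "a = 0" | l r where "r < m" "a = l * m + r + 1"
proof (cases "a = 0")
  case False
  then have "a = (a - 1) div m * m + (a - 1) mod m + 1"
    by (metis One_nat_def Suc_eq_plus1 Suc_pred div_mult_mod_eq neq0_conv)
  with that(2) assms show ?thesis
    using mod_less_divisor by blast
qed (use that in blast)

lemma rot_label:
  assumes "r < m"
  shows "rot m (l * m + r + 1) c = l * m + (r + c) mod m + 1"
  using assms by (simp add: rot_def add.assoc)

text \<open>The last label of a group sits at position \<open>m - 1\<close>, so one rotation step
  wraps around to position 0. This is how the opening letter reaches every label of its
  group.\<close>

lemma rot_multiple:
  assumes "0 < m"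
  shows "rot m (Suc l * m) (Suc r) = l * m + r mod m + 1"
proof -
  have "Suc l * m = l * m + (m - 1) + 1"
    using assms by simp
  then show ?thesis
    using assms rot_label[of "m - 1" m l "Suc r"] by (simp add: add.commute)
qed

lemma rot_id [simp]: "0 < m \<Longrightarrow> rot m a 0 = a"
  by (rule label_cases[of m a]) (auto simp: rot_def)

lemma rot_add:
  assumes "0 < m"
  shows "rot m (rot m a c) d = rot m a (c + d)"
proof (rule label_cases[OF assms, of a])
  fix l r assume a: "r < m" "a = l * m + r + 1"
  have "rot m (rot m a c) d = rot m (l * m + (r + c) mod m + 1) d"
    using a by (simp only: rot_label)
  also have "\<dots> = rot m a (c + d)"
    using a assms by (simp only: rot_label mod_less_divisor) (simp add: mod_simps add.assoc)
  finally show ?thesis .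
qed simp

lemma rot_cong: "c mod m = d mod m \<Longrightarrow> rot m a c = rot m a d"
  unfolding rot_def by (metis mod_add_right_eq)

text \<open>The multiple \<open>(m - 1) * c\<close> serves as the inverse of \<open>c\<close> modulo
  \<open>m\<close> without subtraction, since \<open>c + (m - 1) * c = m * c\<close>.\<close>

lemma rot_cancel: "0 < m \<Longrightarrow> rot m (rot m a c) ((m - 1) * c) = a"
  using rot_cong[of "c + (m - 1) * c" m 0 a]
  by (simp add: rot_add flip: mult_Suc)

lemma rot_cancel': "0 < m \<Longrightarrow> rot m (rot m a ((m - 1) * c)) c = a"
  using rot_cancel[of m a c] by (simp add: rot_add add.commute)

lemma rot_eq_iff:
  assumes "0 < m"
  shows "rot m a c = rot m b d \<longleftrightarrow> a = rot m b (d + (m - 1) * c)"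
  by (metis assms rot_add rot_cancel rot_cancel')

text \<open>A bound \<open>k * m\<close> falls on the boundary between groups, so it constrains only
  the group number. Rotation therefore respects it.\<close>

lemma label_le_iff:
  fixes m l k r :: nat
  assumes "r < m"
  shows "l * m + r + 1 \<le> k * m \<longleftrightarrow> l < k"
proof
  assume "l < k"
  then have "Suc l * m \<le> k * m"
    by (simp only: mult_le_mono1 Suc_leI)
  with assms show "l * m + r + 1 \<le> k * m"
    by simp
next
  assume "l * m + r + 1 \<le> k * m"
  then have "l * m < k * m"
    by linarith
  then show "l < k"
    by simp
qed

lemma rot_le_iff:
  assumes "0 < m"
  shows "rot m a c \<le> k * m \<longleftrightarrow> a \<le> k * m"
proof (rule label_cases[OF assms, of a])
  fix l r assume a: "r < m" "a = l * m + r + 1"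
  show ?thesis
    unfolding a(2) rot_label[OF a(1)] using a(1) assms by (simp only: label_le_iff mod_less_divisor)
qed simp

lemma rot_eq_0_iff [simp]: "rot m a c = 0 \<longleftrightarrow> a = 0"
  by (simp add: rot_def)


section \<open>Points and blocks\<close>

text \<open>Treating the zero vector as base 0 makes the ground set uniform in pairs of base and
  color and removes the special case from \<open>minb\<close>. Note that
  \<open>colored m 0 c\<close> is a different vector, supported at coordinate 0.\<close>

definition pt :: "nat \<Rightarrow> nat \<Rightarrow> nat \<Rightarrow> cvec" where
  "pt m i c = (if i = 0 then zero_vec else colored m i c)"

lemma zeta_power_eq_iff:
  assumes "0 < m"
  shows "zeta m ^ c = zeta m ^ d \<longleftrightarrow> c mod m = d mod m"
proof -
  have z: "zeta m ^ c = cis (2 * pi * real c / real m)" for c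
    by (simp add: zeta_def DeMoivre mult_ac)
  have "zeta m ^ m = 1"
    using assms by (simp add: z)
  then have red: "zeta m ^ c = zeta m ^ (c mod m)" for c
    by (metis div_mult_mod_eq mult.commute mult_1 power_add power_mult power_one)
  have "inj_on (\<lambda>c. zeta m ^ c) {..<m}"
    using bij_betw_roots_unity[OF assms] by (simp add: z bij_betw_def)
  then show ?thesis
    using assms red[of c] red[of d] by (simp add: inj_on_eq_iff)
qed

lemma zeta_nonzero [simp]: "zeta m \<noteq> 0"
  by (simp add: zeta_def)

lemma pt_0 [simp]: "pt m 0 c = zero_vec"
  by (simp add: pt_def)

lemma pt_eq_iff:
  assumes "0 < m"
  shows "pt m i c = pt m j d \<longleftrightarrow> i = j \<and> (i = 0 \<or> c mod m = d mod m)"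
proof -
  have "colored m i c i \<noteq> 0" "colored m j d j \<noteq> 0"
    by (simp_all add: colored_def)
  moreover have "colored m i c = colored m i d \<longleftrightarrow> c mod m = d mod m" for i c d
    by (auto simp: colored_def fun_eq_iff zeta_power_eq_iff[OF assms])
  moreover have "colored m i c \<noteq> colored m j d" if "i \<noteq> j"
    using that zeta_nonzero[of m] by (auto simp: colored_def fun_eq_iff)
  moreover have "zero_vec \<noteq> colored m i c" for i c
    using zeta_nonzero[of m] by (auto simp: zero_vec_def colored_def fun_eq_iff)
  ultimately show ?thesis
    by (auto simp: pt_def dest: sym[of _ zero_vec])
qed

lemma pt_mod: "0 < m \<Longrightarrow> pt m i (c mod m) = pt m i c"
  by (simp add: pt_eq_iff)

lemma ground_eq:
  assumes "0 < m"
  shows "ground m n = {pt m i c | i c. i \<le> n}"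
proof (intro equalityI subsetI)
  fix x assume "x \<in> ground m n"
  then consider "x = zero_vec" | i c where "x = colored m i c" "i \<in> {1..n}"
    unfolding ground_def by blast
  then show "x \<in> {pt m i c | i c. i \<le> n}"
  proof cases
    case 1
    then have "x = pt m 0 0" by simp
    then show ?thesis by blast
  next
    case (2 i c)
    then have "x = pt m i c" "i \<le> n" by (simp_all add: pt_def)
    then show ?thesis by blast
  qed
next
  fix x assume "x \<in> {pt m i c | i c. i \<le> n}"
  then obtain i c where x: "x = pt m i (c mod m)" "i \<le> n"
    using pt_mod[OF assms] by auto
  have "c mod m < m"
    using assms by simp
  show "x \<in> ground m n"
  proof (cases "i = 0")
    case False
    then have "x = colored m i (c mod m)" "i \<in> {1..n}"
      using x by (simp_all add: pt_def)
    with \<open>c mod m < m\<close> show ?thesis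
      unfolding ground_def by blast
  qed (simp add: x ground_def)
qed

lemma pt_in_ground_iff:
  assumes "0 < m"
  shows "pt m i c \<in> ground m n \<longleftrightarrow> i \<le> n"
  using assms by (auto simp: ground_eq pt_eq_iff)

section \<open>Rotation of sets of points\<close>

lemma in_scale_iff:
  assumes "0 < m"
  shows "pt m i c \<in> scale (zeta m ^ d) S \<longleftrightarrow> pt m i (c + (m - 1) * d) \<in> S"
proof -
  let ?f = "\<lambda>s j. zeta m ^ d * s j"
  have "inj ?f"
    by (auto simp: inj_def fun_eq_iff)
  moreover have "pt m i c = ?f (pt m i (c + (m - 1) * d))"
  proof -
    have "zeta m ^ c = zeta m ^ (d + (c + (m - 1) * d))"
    proof -
      have "d + (c + (m - 1) * d) = c + m * d"
        using assms by (cases m) simp_all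
      then show ?thesis
        using assms by (simp only: zeta_power_eq_iff mod_mult_self2)
    qed
    then show ?thesis
      by (auto simp: pt_def zero_vec_def colored_def power_add)
  qed
  ultimately show ?thesis
    unfolding scale_def by (metis inj_image_mem_iff)
qed

lemma pt_in_scale:
  assumes "0 < m" "pt m i c \<in> S"
  shows "pt m i (c + d) \<in> scale (zeta m ^ d) S"
proof -
  have "c + d + (m - 1) * d = c + m * d"
    using assms(1) by (cases m) simp_all
  then have "pt m i (c + d + (m - 1) * d) = pt m i c"
    using assms(1) by (simp only: pt_eq_iff mod_mult_self2) simp
  then show ?thesis
    using assms by (simp add: in_scale_iff)
qed

lemma scale_scale: "scale (zeta m ^ c) (scale (zeta m ^ d) S) = scale (zeta m ^ (d + c)) S"
  unfolding scale_def by (simp add: image_image power_add mult_ac)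

lemma scale_mod: "0 < m \<Longrightarrow> scale (zeta m ^ (c mod m)) S = scale (zeta m ^ c) S"
  using zeta_power_eq_iff[of m "c mod m" c] by simp

lemma scale_subset_ground:
  assumes "0 < m" "S \<subseteq> ground m n"
  shows "scale (zeta m ^ d) S \<subseteq> ground m n"
proof
  fix x assume "x \<in> scale (zeta m ^ d) S"
  then obtain s where s: "s \<in> S" "x = (\<lambda>j. zeta m ^ d * s j)"
    by (auto simp: scale_def)
  then obtain i c where "s = pt m i c" "i \<le> n"
    using assms by (auto simp: ground_eq)
  then have "x = pt m i (c + d)"
    by (auto simp: s pt_def zero_vec_def colored_def power_add)
  then show "x \<in> ground m n"
    using \<open>i \<le> n\<close> assms by (simp add: pt_in_ground_iff)
qed

lemma subset_ground_eqI:
  assumes "0 < m" "S \<subseteq> ground m n" "T \<subseteq> ground m n"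
    and "\<And>i c. i \<le> n \<Longrightarrow> pt m i c \<in> S \<longleftrightarrow> pt m i c \<in> T"
  shows "S = T"
  using assms unfolding ground_eq[OF assms(1)] by blast

text \<open>A vector supported at coordinate 0 is neither zero nor supported on a base from 1 to
  \<open>n\<close>. This excludes a least base 0 wherever the color condition of a standard form
  holds.\<close>

lemma colored_in_groundD:
  assumes "0 < m" "colored m i c \<in> ground m n"
  shows "i \<noteq> 0" "colored m i c = pt m i c"
proof -
  have "colored m 0 c \<noteq> pt m j d" for j d
    using zeta_nonzero[of m]
    by (auto simp: pt_def zero_vec_def colored_def fun_eq_iff)
  then show "i \<noteq> 0"
    using assms unfolding ground_eq[OF assms(1)] by (cases "i = 0") auto
  then show "colored m i c = pt m i c"
    by (simp add: pt_def)
qed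

section \<open>Least bases and their invariance under rotation\<close>

lemma minb_eq:
  assumes "0 < m" "S \<subseteq> ground m n"
  shows "minb m S = (LEAST i. \<exists>c. pt m i c \<in> S)"
proof (cases "zero_vec \<in> S")
  case True
  then have "(LEAST i. \<exists>c. pt m i c \<in> S) = 0"
    by (intro Least_equality) auto
  with True show ?thesis
    by (simp add: minb_def)
next
  case False
  have "(\<exists>c<m. colored m i c \<in> S) \<longleftrightarrow> (\<exists>c. pt m i c \<in> S)" for i
  proof (cases "i = 0")
    case True
    have "colored m 0 c \<notin> S" for c
      using assms(2) colored_in_groundD(1)[OF assms(1)] by blast
    with True False show ?thesis
      by auto
  next
    case i: False
    then show ?thesis
      using pt_mod[OF assms(1), of i] assms(1) unfolding pt_def by (metis mod_less_divisor)
  qed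
  with False show ?thesis
    by (simp add: minb_def)
qed

lemma minb_scale:
  assumes "0 < m" "S \<subseteq> ground m n"
  shows "minb m (scale (zeta m ^ d) S) = minb m S"
proof -
  have "(\<exists>c. pt m i c \<in> scale (zeta m ^ d) S) \<longleftrightarrow> (\<exists>c. pt m i c \<in> S)" for i
    using in_scale_iff[OF assms(1)] pt_in_scale[OF assms(1)] by metis
  then show ?thesis
    using minb_eq[OF assms] minb_eq[OF assms(1) scale_subset_ground[OF assms]] by simp
qed

text \<open>A labelling is encoded by the word whose i-th letter is the index of the block
  containing \<open>i^0\<close>; the letter at position 0 stands for the zero vector and is 0.\<close>

definition blk :: "nat \<Rightarrow> nat list \<Rightarrow> nat \<Rightarrow> cvec set" where
  "blk m w j = {pt m i c | i c. i < length w \<and> rot m (w ! i) c = j}"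

text \<open>The letters closed under rotation, that is, the indices of the nonempty blocks.\<close>

definition labels :: "nat \<Rightarrow> nat list \<Rightarrow> nat set" where
  "labels m w = {rot m (w ! i) c | i c. i < length w}"

lemma labelsI: "i < length w \<Longrightarrow> rot m (w ! i) c \<in> labels m w"
  by (auto simp: labels_def)

section \<open>The blocks of a word\<close>

lemma pt_in_blk_iff:
  assumes "0 < m" "w ! 0 = 0"
  shows "pt m i c \<in> blk m w j \<longleftrightarrow> i < length w \<and> rot m (w ! i) c = j"
proof
  assume "pt m i c \<in> blk m w j"
  then obtain i' c' where "pt m i c = pt m i' c'" "i' < length w" "rot m (w ! i') c' = j"
    by (auto simp: blk_def)
  then show "i < length w \<and> rot m (w ! i) c = j"
    using assms rot_cong[of c m c'] by (auto simp: pt_eq_iff)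
qed (auto simp: blk_def)

lemma blk_subset_ground: "0 < m \<Longrightarrow> length w = Suc n \<Longrightarrow> blk m w j \<subseteq> ground m n"
  by (auto simp: blk_def pt_in_ground_iff)

lemma blk_eq_empty_iff: "blk m w j = {} \<longleftrightarrow> j \<notin> labels m w"
  by (auto simp: blk_def labels_def)

text \<open>Rotating a point by \<open>d\<close> adds \<open>d\<close> to its color, which rotates
  the index of its block by \<open>d\<close>.\<close>

lemma scale_blk:
  assumes "0 < m" "w ! 0 = 0" "w \<noteq> []"
  shows "scale (zeta m ^ d) (blk m w j) = blk m w (rot m j d)"
proof -
  obtain n where n: "length w = Suc n"
    using assms(3) by (cases w) auto
  show ?thesis
  proof (rule subset_ground_eqI[OF assms(1)])
    show "blk m w (rot m j d) \<subseteq> ground m n" "scale (zeta m ^ d) (blk m w j) \<subseteq> ground m n"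
      using n assms by (simp_all add: blk_subset_ground scale_subset_ground)
    have "rot m (rot m a c) ((m - 1) * d) = j \<longleftrightarrow> rot m a c = rot m j d" for a c
      using rot_cancel[OF assms(1)] rot_cancel'[OF assms(1)] by metis
    then show "pt m i c \<in> scale (zeta m ^ d) (blk m w j) \<longleftrightarrow> pt m i c \<in> blk m w (rot m j d)"
      if "i \<le> n" for i c
      using assms by (simp add: in_scale_iff pt_in_blk_iff rot_add)
  qed
qed

lemma blk_inj:
  assumes "0 < m" "w ! 0 = 0"
  shows "inj_on (blk m w) (labels m w)"
proof (rule inj_onI)
  fix a b assume "a \<in> labels m w" "b \<in> labels m w" and eq: "blk m w a = blk m w b"
  then obtain i c where "i < length w" "rot m (w ! i) c = a"
    by (auto simp: labels_def)
  then have "pt m i c \<in> blk m w a"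
    using assms by (simp add: pt_in_blk_iff)
  then show "a = b"
    unfolding eq using assms \<open>rot m (w ! i) c = a\<close> by (simp add: pt_in_blk_iff)
qed

lemma blk_partition:
  assumes "0 < m" "w ! 0 = 0" "length w = Suc n"
  shows "partition_on (ground m n) (blk m w ` labels m w)"
proof (rule partition_onI)
  show "\<Union> (blk m w ` labels m w) = ground m n"
    using assms by (auto simp: ground_eq blk_def labels_def) (metis less_Suc_eq_le)
next
  fix S T assume "S \<in> blk m w ` labels m w" "T \<in> blk m w ` labels m w" "S \<noteq> T"
  then obtain a b where ab: "S = blk m w a" "T = blk m w b" "a \<noteq> b"
    by auto
  show "disjnt S T"
    unfolding disjnt_iff
  proof (intro allI notI)
    fix x assume "x \<in> S \<and> x \<in> T"
    moreover from this obtain i c where "x = pt m i c"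
      unfolding ab by (auto simp: blk_def)
    ultimately show False
      using ab assms by (simp add: pt_in_blk_iff)
  qed
next
  show "{} \<notin> blk m w ` labels m w"
    using blk_eq_empty_iff by (metis imageE)
qed

text \<open>Since the point with color \<open>c\<close> is the rotation of the point with color 0,
  an indexing of the blocks that commutes with rotation is determined by where the color 0 points
  lie. It serves both a rearranged labelling and a standard form as it stands.\<close>

lemma equivariant_labelling:
  assumes "0 < m" and P: "partition_on (ground m n) (B ` {..k * m})" and "inj_on B {..k * m}"
    and "zero_vec \<in> B 0"
    and equi: "\<And>j d. j \<le> k * m \<Longrightarrow> B (rot m j d) = scale (zeta m ^ d) (B j)"
  obtains v where "length v = Suc n" "v ! 0 = 0" "labels m v = {..k * m}"
    "\<And>j. j \<le> k * m \<Longrightarrow> B j = blk m v j"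
proof -
  have "\<exists>j. j \<le> k * m \<and> pt m i 0 \<in> B j" if "i \<le> n" for i
  proof -
    have "pt m i 0 \<in> \<Union> (B ` {..k * m})"
      using partition_onD1[OF P] pt_in_ground_iff[OF assms(1)] that by metis
    then show ?thesis by auto
  qed
  then obtain f where f: "\<And>i. i \<le> n \<Longrightarrow> f i \<le> k * m \<and> pt m i 0 \<in> B (f i)"
    by metis
  define v where "v = map f [0..<Suc n]"
  have len: "length v = Suc n" and v: "v ! i = f i" if "i \<le> n" for i
    using that by (simp_all add: v_def del: upt_Suc)
  have uniq: "a = b" if "x \<in> B a" "x \<in> B b" "a \<le> k * m" "b \<le> k * m" for x a b
  proof -
    have "B a = B b"
    proof (rule ccontr)
      assume "B a \<noteq> B b"
      then have "B a \<inter> B b = {}"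
        using that by (intro disjointD[OF partition_onD2[OF P]]) auto
      with that show False by blast
    qed
    with that assms(3) show ?thesis
      by (simp add: inj_on_eq_iff)
  qed
  have mem: "pt m i c \<in> B (rot m (f i) c)" if "i \<le> n" for i c
    using pt_in_scale[OF assms(1), of i 0 "B (f i)" c] f[OF that] equi by simp
  have le: "rot m (f i) c \<le> k * m" if "i \<le> n" for i c
    using f[OF that] assms(1) by (simp add: rot_le_iff)
  \<comment> \<open>The zero vector lies in \<open>B (f 0)\<close> and in \<open>B 0\<close>, and a
    point has only one index.\<close>
  have v0: "v ! 0 = 0"
    using uniq[of zero_vec "f 0" 0] f[of 0] assms(4) v[of 0] by simp
  have iff: "pt m i c \<in> B j \<longleftrightarrow> rot m (f i) c = j" if "i \<le> n" "j \<le> k * m" for i c j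
    using uniq mem le that by blast
  have sub: "B j \<subseteq> ground m n" if "j \<le> k * m" for j
    using partition_onD1[OF P] that by auto
  have B: "B j = blk m v j" if "j \<le> k * m" for j
  proof (rule subset_ground_eqI[OF assms(1) sub[OF that] blk_subset_ground[OF assms(1) len]])
    show "pt m i c \<in> B j \<longleftrightarrow> pt m i c \<in> blk m v j" if "i \<le> n" for i c
      using that \<open>j \<le> k * m\<close> iff len v v0 assms(1) by (simp add: pt_in_blk_iff)
  qed auto
  have "labels m v = {..k * m}"
  proof
    show "labels m v \<subseteq> {..k * m}"
    proof
      fix j assume "j \<in> labels m v"
      then obtain i c where "i \<le> n" "j = rot m (v ! i) c"
        using len[of 0] by (auto simp: labels_def less_Suc_eq_le)
      with le v show "j \<in> {..k * m}" by simp
    qed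
    show "{..k * m} \<subseteq> labels m v"
    proof
      fix j assume "j \<in> {..k * m}"
      moreover from this have "B j \<noteq> {}"
        using partition_onD3[OF P] by (metis image_eqI)
      ultimately show "j \<in> labels m v"
        using B blk_eq_empty_iff[of m v j] by simp
    qed
  qed
  with that len[of 0] v0 B show thesis
    by blast
qed


section \<open>Restricted growth words\<close>

text \<open>The witness for \<open>l\<close> is the first position whose letter exceeds
  \<open>l * m\<close>: the opening of group \<open>l\<close>, at its last label.\<close>

definition rg :: "nat \<Rightarrow> nat \<Rightarrow> nat list \<Rightarrow> bool" where
  "rg m k w \<longleftrightarrow> w \<noteq> [] \<and> w ! 0 = 0 \<and> (\<forall>i<length w. w ! i \<le> k * m) \<and>
     (\<forall>l<k. \<exists>i<length w. w ! i = Suc l * m \<and> (\<forall>i'<i. w ! i' \<le> l * m))"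

lemma rgD:
  assumes "rg m k w"
  shows "w \<noteq> []" "w ! 0 = 0" "i < length w \<Longrightarrow> w ! i \<le> k * m"
    "l < k \<Longrightarrow> \<exists>i<length w. w ! i = Suc l * m \<and> (\<forall>i'<i. w ! i' \<le> l * m)"
proof -
  note * = assms[unfolded rg_def]
  show "w \<noteq> []" using * by (rule conjunct1)
  show "w ! 0 = 0" using *[THEN conjunct2] by (rule conjunct1)
  show "i < length w \<Longrightarrow> w ! i \<le> k * m"
    using *[THEN conjunct2, THEN conjunct2, THEN conjunct1] by (rule allE) (rule mp)
  show "l < k \<Longrightarrow> \<exists>i<length w. w ! i = Suc l * m \<and> (\<forall>i'<i. w ! i' \<le> l * m)"
    using *[THEN conjunct2, THEN conjunct2, THEN conjunct2] by (rule allE) (rule mp)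
qed

lemma rg_singleton: "0 < m \<Longrightarrow> rg m k [a] \<longleftrightarrow> a = 0 \<and> k = 0"
  by (auto simp: rg_def)

text \<open>Only the last group can be opened by the final letter. If it is, all earlier letters
  stay within \<open>k'\<close> groups; otherwise every opening already lies in
  \<open>w\<close>.\<close>

lemma rg_snoc:
  assumes "0 < m" "w \<noteq> []"
  shows "rg m k (w @ [j]) \<longleftrightarrow> rg m k w \<and> j \<le> k * m \<or> (\<exists>k'. k = Suc k' \<and> rg m k' w \<and> j = k * m)"
    (is "?L \<longleftrightarrow> ?R")
proof
  assume L: ?L
  have w0: "w ! 0 = 0"
    using rgD(2)[OF L] assms(2) by (simp add: nth_append)
  have le: "w ! i \<le> k * m" if "i < length w" for i
    using rgD(3)[OF L, of i] that by (simp add: nth_append)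
  have j: "j \<le> k * m"
    using rgD(3)[OF L, of "length w"] by simp
  have ex: "\<exists>i\<le>length w. (w @ [j]) ! i = Suc l * m \<and> (\<forall>i'<i. w ! i' \<le> l * m)" if l: "l < k" for l
  proof -
    from rgD(4)[OF L l] obtain i where i: "i < length (w @ [j])"
      "(w @ [j]) ! i = Suc l * m" "\<forall>i'<i. (w @ [j]) ! i' \<le> l * m" by blast
    have "w ! i' \<le> l * m" if "i' < i" for i'
      using i(1,3) that by (auto simp: nth_append dest!: spec[of _ i'])
    with i show ?thesis
      by (intro exI[of _ i]) auto
  qed
  show ?R
  proof (cases "\<exists>k'. k = Suc k' \<and> (\<forall>i<length w. w ! i \<le> k' * m) \<and> j = k * m")
    case True
    then obtain k' where k': "k = Suc k'" "\<forall>i<length w. w ! i \<le> k' * m" "j = k * m"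
      by auto
    have "rg m k' w"
      unfolding rg_def
    proof (intro conjI allI impI)
      fix l assume "l < k'"
      then obtain i where i: "i \<le> length w" "(w @ [j]) ! i = Suc l * m" "\<forall>i'<i. w ! i' \<le> l * m"
        using ex[of l] k' by auto
      moreover have "i \<noteq> length w"
      proof
        assume "i = length w"
        then have "(w @ [j]) ! i = j"
          by simp
        then have "Suc l * m = Suc k' * m"
          using i(2) k' by metis
        then show False
          using \<open>l < k'\<close> k' assms(1) by (simp del: mult_Suc)
      qed
      ultimately show "\<exists>i<length w. w ! i = Suc l * m \<and> (\<forall>i'<i. w ! i' \<le> l * m)"
        by (intro exI[of _ i]) (auto simp: nth_append)
    qed (use k' assms w0 in auto)
    with k' show ?thesis by blast
  next
    case False
    have "rg m k w"
      unfolding rg_def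
    proof (intro conjI allI impI)
      fix l assume l: "l < k"
      then obtain i where i: "i \<le> length w" "(w @ [j]) ! i = Suc l * m" "\<forall>i'<i. w ! i' \<le> l * m"
        using ex[of l] by auto
      have "i \<noteq> length w"
      proof
        assume il: "i = length w"
        show False
        proof (cases "Suc l = k")
          case True
          with il i False show False by auto
        next
          case False
          \<comment> \<open>Were group \<open>l\<close> opened at the end, the next group would have
            to be opened later still: earlier letters are too small, and the final letter cannot be
            two different multiples of \<open>m\<close>.\<close>
          then have "Suc l < k" using l by simp
          then obtain i' where i': "i' \<le> length w" "(w @ [j]) ! i' = Suc (Suc l) * m"
            using ex[of "Suc l"] by auto
          have "i' = length w"
          proof (rule ccontr)
            assume "i' \<noteq> length w"
            with i' i il have "Suc (Suc l) * m \<le> l * m"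
              by (auto simp: nth_append simp del: mult_Suc dest!: spec[of _ i'])
            with assms(1) show False by simp
          qed
          with i' i il assms(1) show False
            by simp
        qed
      qed
      with i show "\<exists>i<length w. w ! i = Suc l * m \<and> (\<forall>i'<i. w ! i' \<le> l * m)"
        by (intro exI[of _ i]) (auto simp: nth_append)
    qed (use le assms w0 in auto)
    with j show ?thesis by blast
  qed
next
  assume ?R
  then show ?L
  proof (elim disjE exE conjE)
    assume w: "rg m k w" and j: "j \<le> k * m"
    show ?L
      unfolding rg_def
    proof (intro conjI allI impI)
      fix l assume "l < k"
      then obtain i where "i < length w" "w ! i = Suc l * m" "\<forall>i'<i. w ! i' \<le> l * m"
        using rgD(4)[OF w] by blast
      then show "\<exists>i<length (w @ [j]). (w @ [j]) ! i = Suc l * m \<and> (\<forall>i'<i. (w @ [j]) ! i' \<le> l * m)"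
        by (intro exI[of _ i]) (auto simp: nth_append)
    qed (use rgD[OF w] j in \<open>auto simp: nth_append less_Suc_eq\<close>)
  next
    fix k' assume k: "k = Suc k'" and w: "rg m k' w" and j: "j = k * m"
    have le: "w ! i \<le> k' * m" if "i < length w" for i
      using rgD(3)[OF w that] .
    show ?L
      unfolding rg_def
    proof (intro conjI allI impI)
      fix l assume l: "l < k"
      show "\<exists>i<length (w @ [j]). (w @ [j]) ! i = Suc l * m \<and> (\<forall>i'<i. (w @ [j]) ! i' \<le> l * m)"
      proof (cases "l = k'")
        case True
        then show ?thesis
          using le k j by (intro exI[of _ "length w"]) (auto simp: nth_append)
      next
        case False
        then obtain i where "i < length w" "w ! i = Suc l * m" "\<forall>i'<i. w ! i' \<le> l * m"
          using rgD(4)[OF w, of l] l k by auto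
        then show ?thesis
          by (intro exI[of _ i]) (auto simp: nth_append)
      qed
    qed (use rgD[OF w] le j k in \<open>auto simp: nth_append less_Suc_eq intro: trans_le_add2\<close>)
  qed
qed

text \<open>Each opening letter rotates through its whole group, so no label is skipped.\<close>

lemma labels_rg:
  assumes "0 < m" "rg m k w"
  shows "labels m w = {..k * m}"
proof
  show "labels m w \<subseteq> {..k * m}"
    using assms rgD(3)[OF assms(2)] by (auto simp: labels_def rot_le_iff)
  show "{..k * m} \<subseteq> labels m w"
  proof
    fix j assume j: "j \<in> {..k * m}"
    show "j \<in> labels m w"
    proof (rule label_cases[OF assms(1), of j])
      assume "j = 0"
      then show ?thesis
        using rgD(1,2)[OF assms(2)] unfolding labels_def
        by (intro CollectI exI[of _ 0]) auto
    next
      fix l r assume r: "r < m" "j = l * m + r + 1"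
      then have "l < k"
        using j by (simp only: atMost_iff label_le_iff)
      then obtain i where i: "i < length w" "w ! i = Suc l * m"
        using rgD(4)[OF assms(2)] by blast
      have "rot m (w ! i) (Suc r) = j"
        using r assms(1) by (simp only: i rot_multiple mod_less)
      then show ?thesis
        using labelsI[OF i(1), of m "Suc r"] by simp
    qed
  qed
qed

lemma rg_unique_size: "0 < m \<Longrightarrow> rg m k w \<Longrightarrow> rg m k' w \<Longrightarrow> k = k'"
  using labels_rg[of m k w] labels_rg[of m k' w] by simp


section \<open>Words with the same partition\<close>

text \<open>The kernel of a word: it records which points of color 0 share a block with which
  colored points, and forgets the names of the blocks. Rotating one side suffices, as a rotation on
  the other can be inverted.\<close>

definition keq :: "nat \<Rightarrow> nat list \<Rightarrow> nat list \<Rightarrow> bool" where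
  "keq m v w \<longleftrightarrow> length v = length w \<and>
     (\<forall>i<length v. \<forall>j<length v. \<forall>c. v ! i = rot m (v ! j) c \<longleftrightarrow> w ! i = rot m (w ! j) c)"

lemma keqD:
  assumes "0 < m" "keq m v w" "i < length v" "j < length v"
  shows "rot m (v ! i) c = rot m (v ! j) d \<longleftrightarrow> rot m (w ! i) c = rot m (w ! j) d"
  unfolding rot_eq_iff[OF assms(1)] using assms unfolding keq_def by blast

text \<open>Comparing the new letter with itself and comparing old letters with the new one add no
  conditions: a letter fixed by a rotation is 0 or the rotation is trivial, and the other comparison
  follows by inverting rotations.\<close>

lemma keq_snoc:
  assumes "0 < m" "v \<noteq> []" "v ! 0 = 0" "w ! 0 = 0" "length v = length w"
  shows "keq m (v @ [a]) (w @ [b]) \<longleftrightarrow>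
    keq m v w \<and> (\<forall>i<length v. \<forall>c. a = rot m (v ! i) c \<longleftrightarrow> b = rot m (w ! i) c)" (is "?L \<longleftrightarrow> ?R")
proof
  assume L: ?L
  have "keq m v w"
    unfolding keq_def
  proof (intro conjI allI impI)
    fix i j c assume "i < length v" "j < length v"
    moreover from this have
      "(v @ [a]) ! i = rot m ((v @ [a]) ! j) c \<longleftrightarrow> (w @ [b]) ! i = rot m ((w @ [b]) ! j) c"
      using L unfolding keq_def by simp
    ultimately show "v ! i = rot m (v ! j) c \<longleftrightarrow> w ! i = rot m (w ! j) c"
      using assms(5) by (simp add: nth_append)
  qed fact
  moreover have "a = rot m (v ! i) c \<longleftrightarrow> b = rot m (w ! i) c" if "i < length v" for i c
  proof -
    have "(v @ [a]) ! length v = rot m ((v @ [a]) ! i) c \<longleftrightarrow>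
      (w @ [b]) ! length v = rot m ((w @ [b]) ! i) c"
      using L that unfolding keq_def by simp
    with that assms(5) show ?thesis
      by (simp add: nth_append)
  qed
  ultimately show ?R by blast
next
  assume R: ?R
  have ab: "a = rot m (v ! i) c \<longleftrightarrow> b = rot m (w ! i) c" if "i < length v" for i c
    using R that by blast
  \<comment> \<open>Position 0 holds the letter 0 in both words, so comparison with it detects the
    zero block.\<close>
  have "a = 0 \<longleftrightarrow> b = 0"
    using ab[of 0 0] assms by (cases v) auto
  moreover have fix_iff: "x = rot m x c \<longleftrightarrow> x = 0 \<or> c mod m = 0" for x c
  proof (rule label_cases[OF assms(1), of x])
    fix l r assume x: "r < m" "x = l * m + r + 1"
    have "(r + c) mod m = r \<longleftrightarrow> c mod m = 0"
    proof
      assume "(r + c) mod m = r"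
      then have "[r + c = r] (mod m)"
        using x by (simp add: cong_def)
      then have "[c = 0] (mod m)"
        by (simp only: cong_add_lcancel_0_nat)
      then show "c mod m = 0"
        by (simp add: cong_def)
    next
      assume "c mod m = 0"
      then show "(r + c) mod m = r"
        using x by (metis add_0_right mod_add_right_eq mod_less)
    qed
    then show ?thesis
      using x by (simp only: rot_label) auto
  qed simp
  moreover have "v ! i = rot m a c \<longleftrightarrow> w ! i = rot m b c" if "i < length v" for i c
  proof -
    have "x = rot m y c \<longleftrightarrow> y = rot m x ((m - 1) * c)" for x y
      using rot_cancel[OF assms(1)] rot_cancel'[OF assms(1)] by metis
    then show ?thesis
      using ab[OF that] by simp
  qed
  ultimately show ?L
    using R ab assms(5) fix_iff[of a] fix_iff[of b]
    by (auto simp: keq_def nth_append less_Suc_eq)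
qed

text \<open>Rewrite the word letter by letter: a rotation of an earlier letter is copied as the same
  rotation of its replacement, any other letter opens the next group.\<close>

lemma keq_canonical:
  assumes "0 < m" "v \<noteq> []" "v ! 0 = 0"
  obtains k w where "rg m k w" "keq m v w"
proof -
  have "\<exists>k w. rg m k w \<and> keq m v w"
    using assms(2,3)
  proof (induction v rule: rev_nonempty_induct)
    case (single a)
    then have "rg m 0 [0]" "keq m [a] [0]"
      using assms(1) by (simp_all add: rg_singleton keq_def)
    then show ?case by blast
  next
    case (snoc a v)
    then have v0: "v ! 0 = 0"
      by (simp add: nth_append)
    with snoc obtain k w where w: "rg m k w" "keq m v w"
      by blast
    have len: "length v = length w"
      using w by (simp add: keq_def)
    note snoc_iff = keq_snoc[OF assms(1) snoc.hyps(1) v0 rgD(2)[OF w(1)] len]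
    note rg_iff = rg_snoc[OF assms(1) rgD(1)[OF w(1)]]
    show ?case
    proof (cases "\<exists>i<length v. \<exists>c. a = rot m (v ! i) c")
      case True
      then obtain i c where i: "i < length v" "a = rot m (v ! i) c" by blast
      define b where "b = rot m (w ! i) c"
      have "b \<le> k * m"
        using rgD(3)[OF w(1)] i len assms(1) by (simp add: b_def rot_le_iff)
      then have "rg m k (w @ [b])"
        using w by (simp add: rg_iff)
      moreover have "keq m (v @ [a]) (w @ [b])"
        using w i keqD[OF assms(1) w(2)] by (simp add: snoc_iff b_def)
      ultimately show ?thesis by blast
    next
      case False
      have "rg m (Suc k) (w @ [Suc k * m])"
        using w rg_iff by blast
      \<comment> \<open>The fresh letter exceeds every label in use, so on both sides no comparison
        with an earlier letter holds.\<close>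
      moreover have "Suc k * m \<noteq> rot m (w ! i) c" if "i < length w" for i c
      proof -
        have "rot m (w ! i) c \<le> k * m"
          using rgD(3)[OF w(1) that] assms(1) by (simp add: rot_le_iff)
        with assms(1) show ?thesis by simp
      qed
      then have "keq m (v @ [a]) (w @ [Suc k * m])"
        using w False len by (auto simp: snoc_iff simp del: mult_Suc)
      ultimately show ?thesis by blast
    qed
  qed
  with that show thesis by blast
qed

text \<open>By induction the prefixes agree. A last letter within the open groups is a rotation of
  an earlier letter, which determines its partner; otherwise both words open the same next
  group.\<close>

lemma keq_rg_unique:
  assumes "0 < m" "rg m k w" "rg m k' w'" "keq m w w'"
  shows "w = w'"
  using rgD(1)[OF assms(2)] assms(2-4)
proof (induction w arbitrary: w' k k' rule: rev_nonempty_induct)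
  case (single a)
  then obtain a' where "w' = [a']"
    by (cases w') (auto simp: keq_def)
  with single assms(1) show ?case
    by (simp add: rg_singleton)
next
  case (snoc a w)
  then have "length w' = Suc (length w)"
    by (simp add: keq_def)
  then obtain u b where w': "w' = u @ [b]" and len: "length w = length u"
    by (metis length_Suc_conv_rev)
  then have u: "u \<noteq> []"
    using snoc.hyps by auto
  obtain p where p: "rg m p w" "a \<le> p * m \<or> a = Suc p * m"
    using snoc.prems(1) rg_snoc[OF assms(1) snoc.hyps(1)] by blast
  obtain p' where p': "rg m p' u" "b \<le> p' * m \<or> b = Suc p' * m"
    using snoc.prems(2) rg_snoc[OF assms(1) u] w' by blast
  have k: "keq m w u" "\<And>i c. i < length w \<Longrightarrow> a = rot m (w ! i) c \<longleftrightarrow> b = rot m (u ! i) c"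
    using snoc.prems(3) keq_snoc[OF assms(1) snoc.hyps(1) rgD(2)[OF p(1)] rgD(2)[OF p'(1)] len]
    unfolding w' by blast+
  have wu: "w = u"
    using snoc.IH p p' k by blast
  then have "p = p'"
    using rg_unique_size assms(1) p p' by blast
  have eq: "x = y" if "x \<le> p * m" "\<And>i c. i < length w \<Longrightarrow> x = rot m (w ! i) c \<longleftrightarrow> y = rot m (w ! i) c"
    for x y
  proof -
    have "x \<in> labels m w"
      using that(1) labels_rg[OF assms(1) p(1)] by simp
    then obtain i c where "i < length w" "x = rot m (w ! i) c"
      by (auto simp: labels_def)
    with that(2) show "x = y"
      by metis
  qed
  have "a = b"
    using p(2) p'(2) eq[of a b] eq[of b a] k(2) wu \<open>p = p'\<close> by auto
  with wu w' show ?case by simp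
qed

text \<open>The block through a given point is the same set for both words, though its label may
  differ.\<close>

lemma keq_blk_image:
  assumes "0 < m" "v ! 0 = 0" "w ! 0 = 0" "keq m v w"
  shows "blk m v ` labels m v = blk m w ` labels m w"
proof -
  have len: "length v = length w"
    using assms(4) by (simp add: keq_def)
  have eq: "blk m v (rot m (v ! i) c) = blk m w (rot m (w ! i) c)" if "i < length w" for i c
  proof -
    have "rot m (v ! j) d = rot m (v ! i) c \<longleftrightarrow> rot m (w ! j) d = rot m (w ! i) c"
      if "j < length w" for j d
      using keqD[OF assms(1,4)] that \<open>i < length w\<close> len by simp
    then show ?thesis
      unfolding blk_def len by (simp cong: conj_cong)
  qed
  have image: "blk m u ` labels m u = (\<lambda>(i, c). blk m u (rot m (u ! i) c)) ` ({..<length u} \<times> UNIV)"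
    for u
    unfolding labels_def by force
  show ?thesis
    unfolding image len by (intro image_cong) (auto simp: eq)
qed

text \<open>Conversely, the kernel is recovered from the set of blocks by asking whether two points
  have a common block.\<close>

lemma blk_image_keq:
  assumes "0 < m" "v ! 0 = 0" "w ! 0 = 0" "length v = length w"
    and "blk m v ` labels m v = blk m w ` labels m w"
  shows "keq m v w"
proof -
  have same: "(\<exists>S\<in>blk m u ` labels m u. pt m i 0 \<in> S \<and> pt m j c \<in> S) \<longleftrightarrow> u ! i = rot m (u ! j) c"
    (is "?L \<longleftrightarrow> ?R") if u: "u ! 0 = 0" "i < length u" "j < length u" for u i j c
  proof
    assume ?L
    then obtain x where "pt m i 0 \<in> blk m u x" "pt m j c \<in> blk m u x"
      by blast
    with u assms(1) show ?R
      by (simp add: pt_in_blk_iff)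
  next
    assume ?R
    then have "pt m i 0 \<in> blk m u (u ! i)" "pt m j c \<in> blk m u (u ! i)"
      using u assms(1) by (simp_all add: pt_in_blk_iff)
    moreover have "u ! i \<in> labels m u"
      using labelsI[OF u(2), of m 0] assms(1) by simp
    ultimately show ?L
      by blast
  qed
  show ?thesis
    unfolding keq_def
  proof (intro conjI allI impI)
    fix i j c assume "i < length v" "j < length v"
    then show "v ! i = rot m (v ! j) c \<longleftrightarrow> w ! i = rot m (w ! j) c"
      using same[of v i j c] same[of w i j c] assms by simp
  qed fact
qed

section \<open>Words and standard forms\<close>

lemma zero_in_blk: "0 < m \<Longrightarrow> rg m k w \<Longrightarrow> zero_vec \<in> blk m w 0"
  using pt_in_blk_iff[of m w 0 0 0] rgD(1,2)[of m k w] by simp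

lemma minb_zero: "zero_vec \<in> S \<Longrightarrow> minb m S = 0"
  by (simp add: minb_def)

text \<open>A base in a block of group \<open>l\<close> has its letter in that group, hence above
  \<open>l * m\<close>, and so is not before \<open>s\<close>; the rotations of \<open>s\<close>
  meet every block of the group.\<close>

lemma rg_minb:
  assumes "0 < m" "rg m k w" "r < m" "s < length w" "w ! s = Suc l * m" "\<forall>i<s. w ! i \<le> l * m"
  shows "minb m (blk m w (l * m + r + 1)) = s"
proof -
  note iff = pt_in_blk_iff[OF assms(1) rgD(2)[OF assms(2)]]
  obtain n where "length w = Suc n"
    using rgD(1)[OF assms(2)] by (cases w) auto
  then have "minb m (blk m w (l * m + r + 1)) = (LEAST i. \<exists>c. pt m i c \<in> blk m w (l * m + r + 1))"
    by (rule minb_eq[OF assms(1) blk_subset_ground[OF assms(1)]])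
  also have "\<dots> = s"
  proof (rule Least_equality)
    have "rot m (w ! s) (Suc r) = l * m + r + 1"
      unfolding assms(5) using assms(1,3) by (simp only: rot_multiple mod_less)
    then show "\<exists>c. pt m s c \<in> blk m w (l * m + r + 1)"
      using iff assms(4) by blast
  next
    fix i assume "\<exists>c. pt m i c \<in> blk m w (l * m + r + 1)"
    then obtain c where c: "rot m (w ! i) c = l * m + r + 1"
      using iff by blast
    show "s \<le> i"
    proof (rule ccontr)
      assume "\<not> s \<le> i"
      then have "w ! i \<le> l * m"
        using assms(6) by simp
      then have "rot m (w ! i) c \<le> l * m"
        using rot_le_iff[OF assms(1)] by blast
      with c show False by simp
    qed
  qed
  finally show ?thesis .
qed

text \<open>Letters before the opening of the group of \<open>j\<close> are below \<open>j\<close>,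
  whereas the opening letter, being the last label of the group, is at least
  \<open>j\<close>.\<close>

lemma rg_minb_le_iff:
  assumes "0 < m" "rg m k w" "j \<le> k * m"
  shows "minb m (blk m w j) \<le> i \<longleftrightarrow> (\<exists>i'\<le>i. j \<le> w ! i')"
proof (rule label_cases[OF assms(1), of j])
  assume "j = 0"
  then show ?thesis
    using minb_zero[OF zero_in_blk[OF assms(1,2)]] by auto
next
  fix l r assume j: "r < m" "j = l * m + r + 1"
  then have "l < k"
    using assms(3) by (simp only: label_le_iff)
  then obtain s where s: "s < length w" "w ! s = Suc l * m" "\<forall>i<s. w ! i \<le> l * m"
    using rgD(4)[OF assms(2)] by blast
  have minb: "minb m (blk m w j) = s"
    using rg_minb[OF assms(1,2) j(1) s] j(2) by simp
  have "j \<le> w ! s"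
    using j s(2) by simp
  moreover have "s \<le> i'" if "j \<le> w ! i'" for i'
  proof (rule ccontr)
    assume "\<not> s \<le> i'"
    then have "w ! i' \<le> l * m"
      using s(3) by simp
    with that j show False by simp
  qed
  ultimately show ?thesis
    unfolding minb using order_trans by blast
qed

lemma standard_form_word:
  assumes m: "0 < m" and w: "rg m k w" and n: "length w = Suc n"
  shows "standard_form m n k (blk m w ` {..k * m}) (map (blk m w) [0..<Suc (k * m)])"
proof -
  define Ss where "Ss = map (blk m w) [0..<Suc (k * m)]"
  have nth: "Ss ! j = blk m w j" if "j \<le> k * m" for j
    using that by (simp add: Ss_def nth_map_upt del: upt_Suc)
  have Ss0: "Ss ! 0 = blk m w 0"
    by (simp add: nth)
  note iff = pt_in_blk_iff[OF m rgD(2)[OF w]]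
  have labels: "labels m w = {..k * m}"
    by (rule labels_rg[OF m w])
  have wit: "\<exists>s<length w. w ! s = Suc l * m \<and> (\<forall>i<s. w ! i \<le> l * m)" if "l < k" for l
    using rgD(4)[OF w that] .
  have "labelling m n k (blk m w ` {..k * m}) Ss"
    unfolding labelling_def
  proof (intro conjI ballI allI impI)
    show "length Ss = k * m + 1"
      by (simp add: Ss_def)
    show "distinct Ss"
      using blk_inj[OF m rgD(2)[OF w]] unfolding labels Ss_def
      by (simp add: distinct_map atLeast0LessThan lessThan_Suc_atMost del: upt_Suc)
    show "set Ss = blk m w ` {..k * m}"
      by (simp add: Ss_def atLeast0LessThan lessThan_Suc_atMost del: upt_Suc)
    show "zero_vec \<in> Ss ! 0"
      using zero_in_blk[OF m w] by (simp add: nth)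
  next
    fix i d assume i: "i \<in> {1..n}" and "\<exists>c<m. colored m i c \<in> Ss ! 0"
    then obtain c where "pt m i c \<in> blk m w 0"
      by (auto simp: pt_def nth)
    then have "pt m i d \<in> blk m w 0"
      by (simp add: iff)
    with i show "colored m i d \<in> Ss ! 0"
      by (simp add: pt_def nth)
  next
    fix l assume l: "l < k"
    have "{l * m + 1..(l + 1) * m} = (\<lambda>c. l * m + c + 1) ` {..<m}"
    proof
      show "{l * m + 1..(l + 1) * m} \<subseteq> (\<lambda>c. l * m + c + 1) ` {..<m}"
      proof
        fix x assume "x \<in> {l * m + 1..(l + 1) * m}"
        then show "x \<in> (\<lambda>c. l * m + c + 1) ` {..<m}"
          by (intro image_eqI[of _ _ "x - (l * m + 1)"]) auto
      qed
    qed auto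
    moreover have "Ss ! (l * m + c + 1) = scale (zeta m ^ c) (blk m w (l * m + 0 + 1))"
      if "c < m" for c
    proof -
      have "l * m + c + 1 \<le> k * m"
        using that l by (simp only: label_le_iff)
      then show ?thesis
        unfolding scale_blk[OF m rgD(2)[OF w] rgD(1)[OF w]] rot_label[OF m]
        using that by (simp add: nth)
    qed
    ultimately have "(!) Ss ` {l * m + 1..(l + 1) * m} =
        (\<lambda>c. scale (zeta m ^ c) (blk m w (l * m + 0 + 1))) ` {..<m}"
      by (simp only: image_image) (intro image_cong, simp_all)
    then show "\<exists>T. (!) Ss ` {l * m + 1..(l + 1) * m} = (\<lambda>c. scale (zeta m ^ c) T) ` {..<m}"
      by blast
  qed
  moreover have "minb m (Ss ! 0) = 0"
    unfolding Ss0 by (rule minb_zero[OF zero_in_blk[OF m w]])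
  moreover have "minb m (Ss ! (l * m)) < minb m (Ss ! ((l + 1) * m))" if l: "l < k" for l
  proof -
    obtain s where s: "s < length w" "w ! s = Suc l * m" "\<forall>i<s. w ! i \<le> l * m"
      using wit[OF l] by blast
    have le: "l * m \<le> k * m" "(l + 1) * m \<le> k * m"
      using l by (simp_all only: mult_le_mono1 less_imp_le Suc_eq_plus1[symmetric] Suc_leI)
    have "(l + 1) * m = l * m + (m - 1) + 1"
      using m by simp
    then have minb: "minb m (Ss ! ((l + 1) * m)) = s"
      using rg_minb[OF m w _ s, of "m - 1"] m nth[OF le(2)] by (simp add: add.commute)
    \<comment> \<open>The position is 0 if \<open>l = 0\<close>, and otherwise the opening of the
      preceding group.\<close>
    have "\<exists>i'<s. l * m \<le> w ! i'"
    proof (cases l)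
      case 0
      have "s \<noteq> 0"
        using s(2) rgD(2)[OF w] m by (metis mult_is_0 nat.distinct(1) less_irrefl)
      with 0 show ?thesis by auto
    next
      case (Suc l')
      then obtain s' where s': "w ! s' = l * m" "\<forall>i<s'. w ! i \<le> l' * m"
        using wit[of l'] l by auto
      have "\<not> s < s'"
        using s'(2) s(2) Suc m by auto
      moreover have "s \<noteq> s'"
        using s' s(2) m by auto
      ultimately show ?thesis
        using s'(1) by (intro exI[of _ s']) auto
    qed
    then obtain i' where i': "i' < s" "l * m \<le> w ! i'" by blast
    then have "minb m (blk m w (l * m)) \<le> i'"
      using rg_minb_le_iff[OF m w le(1)] by blast
    then show ?thesis
      unfolding minb nth[OF le(1)] using i'(1) by simp
  qed
  moreover have "colored m (minb m (Ss ! j)) (j mod m) \<in> Ss ! j" if j: "j \<in> {1..k * m}" for j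
  proof (rule label_cases[OF m, of j])
    fix l r assume r: "r < m" "j = l * m + r + 1"
    have le: "j \<le> k * m"
      using j by simp
    then have "l < k"
      unfolding r(2) using r(1) by (simp only: label_le_iff)
    then obtain s where s: "s < length w" "w ! s = Suc l * m" "\<forall>i<s. w ! i \<le> l * m"
      using wit by blast
    have minb: "minb m (Ss ! j) = s"
      using rg_minb[OF m w r(1) s] r(2) nth[OF le] by simp
    have "s \<noteq> 0"
      using s(2) rgD(2)[OF w] m by (metis mult_is_0 nat.distinct(1) less_irrefl)
    \<comment> \<open>The opening has color 0 in the last block, so its color in block
      \<open>j\<close> is \<open>r + 1\<close>, which is \<open>j\<close> modulo
      \<open>m\<close>.\<close>
    have "j = Suc r + l * m"
      using r(2) by simp
    then have "j mod m mod m = Suc r mod m"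
      by simp
    then have "rot m (w ! s) (j mod m) = rot m (Suc l * m) (Suc r)"
      unfolding s(2) by (rule rot_cong)
    also have "\<dots> = j"
      unfolding r(2) using r(1) by (simp only: rot_multiple[OF m] mod_less)
    finally have "pt m s (j mod m) \<in> blk m w j"
      using s(1) by (simp only: iff)
    then show ?thesis
      unfolding minb unfolding nth[OF le] using \<open>s \<noteq> 0\<close> by (simp add: pt_def)
  qed (use j in simp)
  ultimately show ?thesis
    unfolding standard_form_def Ss_def by blast
qed

text \<open>In a restricted growth word the least base of block \<open>l\<close> is the first position whose letter
  is at least \<open>l\<close>, which turns the condition on \<open>minb\<close> into the existential one below.\<close>

definition winv :: "nat list \<Rightarrow> nat" where
  "winv w = card {(i, l). i < length w \<and> w ! i < l \<and> (\<exists>i'\<le>i. l \<le> w ! i')}"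

lemma card_inversions:
  assumes m: "0 < m" and w: "rg m k w" and n: "length w = Suc n"
  shows "card (inversions m n (map (blk m w) [0..<Suc (k * m)])) = winv w"
proof -
  define Ss where "Ss = map (blk m w) [0..<Suc (k * m)]"
  define X where "X = {(i, l). i < length w \<and> w ! i < l \<and> (\<exists>i'\<le>i. l \<le> w ! i')}"
  define f where "f = (\<lambda>(i, l). (pt m i 0, blk m w l))"
  note iff = pt_in_blk_iff[OF m rgD(2)[OF w]]
  have len: "length Ss = Suc (k * m)"
    by (simp add: Ss_def)
  have nth: "Ss ! j = blk m w j" if "j \<le> k * m" for j
    using that by (simp add: Ss_def nth_map_upt del: upt_Suc)
  have X: "1 \<le> i \<and> i \<le> n \<and> w ! i < l \<and> l \<le> k * m \<and> minb m (blk m w l) \<le> i" if "(i, l) \<in> X" for i l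
  proof -
    from that obtain i' where i': "i < length w" "w ! i < l" "i' \<le> i" "l \<le> w ! i'"
      by (auto simp: X_def)
    \<comment> \<open>At position 0 the only choice is \<open>i' = 0\<close>, giving
      \<open>l \<le> w ! 0 < l\<close>.\<close>
    then have "i \<noteq> 0"
      by (metis le_zero_eq not_less)
    moreover have "l \<le> k * m"
      using i' rgD(3)[OF w, of i'] by simp
    moreover from this have "minb m (blk m w l) \<le> i"
      using i' rg_minb_le_iff[OF m w] by blast
    ultimately show ?thesis
      using i' n by simp
  qed
  have "inversions m n Ss = f ` X"
  proof (intro equalityI subsetI)
    fix x assume "x \<in> inversions m n Ss"
    then obtain i j l where x: "x = (colored m i 0, Ss ! l)" "i \<in> {1..n}" "j < l" "l < length Ss"
      "colored m i 0 \<in> Ss ! j" "minb m (Ss ! l) \<le> i"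
      unfolding inversions_def by blast
    then have le: "l \<le> k * m" "j \<le> k * m"
      using len by simp_all
    have "pt m i 0 \<in> blk m w j"
      using x nth[OF le(2)] by (simp add: pt_def)
    then have "w ! i = j"
      using m by (simp add: iff)
    moreover have "\<exists>i'\<le>i. l \<le> w ! i'"
      using x(6) unfolding nth[OF le(1)] rg_minb_le_iff[OF m w le(1)] .
    ultimately have "(i, l) \<in> X"
      using x n by (simp add: X_def)
    moreover have "x = f (i, l)"
      using x nth[OF le(1)] by (simp add: f_def pt_def)
    ultimately show "x \<in> f ` X"
      by blast
  next
    fix x assume "x \<in> f ` X"
    then obtain i l where il: "(i, l) \<in> X" "x = (pt m i 0, blk m w l)"
      by (auto simp: f_def)
    note * = X[OF il(1)]
    then have le: "w ! i \<le> k * m"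
      by simp
    have "pt m i 0 \<in> blk m w (w ! i)"
      using * n m by (simp add: iff)
    then have "colored m i 0 \<in> Ss ! (w ! i)"
      using * nth[OF le] by (simp add: pt_def)
    moreover have "x = (colored m i 0, Ss ! l)"
      using il * nth[of l] by (simp add: pt_def)
    moreover have "minb m (Ss ! l) \<le> i"
      using * nth[of l] by simp
    ultimately show "x \<in> inversions m n Ss"
      unfolding inversions_def using * len
      by (intro CollectI exI[of _ i] exI[of _ "w ! i"] exI[of _ l]) auto
  qed
  moreover have "inj_on f X"
  proof (rule inj_onI)
    fix x y assume xy: "x \<in> X" "y \<in> X" "f x = f y"
    obtain i l i' l' where *: "x = (i, l)" "y = (i', l')"
      by fastforce
    have "l \<in> labels m w" "l' \<in> labels m w"
      using X xy * unfolding labels_rg[OF m w] by auto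
    moreover have "blk m w l = blk m w l'" "i = i'"
      using xy * pt_eq_iff[OF m] by (auto simp: f_def)
    ultimately show "x = y"
      using blk_inj[OF m rgD(2)[OF w]] * by (simp add: inj_on_eq_iff)
  qed
  ultimately show ?thesis
    unfolding winv_def X_def[symmetric] Ss_def[symmetric] by (simp add: card_image)
qed


section \<open>Labellings are given by words\<close>

lemma scale_zero_block:
  assumes m: "0 < m" and P: "partition_on (ground m n) \<sigma>" and L: "labelling m n k \<sigma> Ss"
  shows "scale (zeta m ^ d) (Ss ! 0) = Ss ! 0"
proof -
  have "Ss ! 0 \<in> \<sigma>"
    using L by (auto simp: labelling_def intro: nth_mem)
  then have sub: "Ss ! 0 \<subseteq> ground m n"
    using partition_onD1[OF P] by blast
  have *: "pt m i e \<in> Ss ! 0" if "i \<le> n" "pt m i c \<in> Ss ! 0" for i c e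
  proof (cases "i = 0")
    case False
    have less: "c mod m < m" "e mod m < m"
      using m by simp_all
    have "colored m i (c mod m) \<in> Ss ! 0"
      using that(2) pt_mod[OF m, of i c] False by (simp add: pt_def)
    then have "colored m i (e mod m) \<in> Ss ! 0"
      using L less that(1) False unfolding labelling_def by (metis atLeastAtMost_iff less_one not_le)
    then show ?thesis
      using pt_mod[OF m, of i e] False by (simp add: pt_def)
  qed (use that in simp)
  show ?thesis
  proof (rule subset_ground_eqI[OF m scale_subset_ground[OF m sub] sub])
    show "pt m i c \<in> scale (zeta m ^ d) (Ss ! 0) \<longleftrightarrow> pt m i c \<in> Ss ! 0" if "i \<le> n" for i c
      using *[OF that] unfolding in_scale_iff[OF m] by blast
  qed
qed

lemma labelling_nth_image:
  assumes "labelling m n k \<sigma> Ss"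
  shows "(!) Ss ` {..k * m} = \<sigma>" "inj_on ((!) Ss) {..k * m}"
proof -
  have *: "length Ss = Suc (k * m)" "distinct Ss" "set Ss = \<sigma>"
    using assms by (simp_all add: labelling_def)
  show "(!) Ss ` {..k * m} = \<sigma>"
    using * by (auto simp: set_conv_nth less_Suc_eq_le)
  show "inj_on ((!) Ss) {..k * m}"
    using * by (auto simp: inj_on_def nth_eq_iff_index_eq)
qed

lemma labelling_groups:
  assumes "labelling m n k \<sigma> Ss"
  obtains T where "\<And>l. l < k \<Longrightarrow>
    (!) Ss ` {l * m + 1..(l + 1) * m} = (\<lambda>c. scale (zeta m ^ c) (T l)) ` {..<m}"
proof -
  have "\<forall>l<k. \<exists>T. (!) Ss ` {l * m + 1..(l + 1) * m} = (\<lambda>c. scale (zeta m ^ c) T) ` {..<m}"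
    using assms unfolding labelling_def by (elim conjE)
  with that show thesis
    by metis
qed

text \<open>Rearrange the labelling so that it commutes with rotation, read off a word, and pass to
  the restricted growth word with the same kernel. Counting blocks shows that the number of groups
  is unchanged.\<close>

lemma labelling_word:
  assumes m: "0 < m" and P: "partition_on (ground m n) \<sigma>" and L: "labelling m n k \<sigma> Ss"
  obtains w where "rg m k w" "length w = Suc n" "\<sigma> = blk m w ` {..k * m}"
proof -
  obtain T where T: "\<And>l. l < k \<Longrightarrow>
      (!) Ss ` {l * m + 1..(l + 1) * m} = (\<lambda>c. scale (zeta m ^ c) (T l)) ` {..<m}"
    using labelling_groups[OF L] by blast
  note image = labelling_nth_image[OF L]
  \<comment> \<open>A labelling may list a group in any order; \<open>B\<close> lists it in rotation
    order starting from \<open>T l\<close>.\<close>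
  define B where "B j = (if j = 0 then Ss ! 0 else scale (zeta m ^ ((j - 1) mod m)) (T ((j - 1) div m)))"
    for j
  have B0: "B 0 = Ss ! 0"
    by (simp add: B_def)
  have B: "B (l * m + r + 1) = scale (zeta m ^ r) (T l)" if "r < m" for l r
    using that by (simp add: B_def)
  have "B j \<in> \<sigma>" if "j \<le> k * m" for j
  proof (rule label_cases[OF m, of j])
    assume "j = 0"
    then show ?thesis
      using image(1) B0 by auto
  next
    fix l r assume r: "r < m" "j = l * m + r + 1"
    have l: "l < k"
      using that unfolding r(2) label_le_iff[OF r(1)] .
    have "B j \<in> (!) Ss ` {l * m + 1..(l + 1) * m}"
      unfolding T[OF l] r(2) B[OF r(1)] using r(1) by blast
    moreover have "(l + 1) * m \<le> k * m"
      using l by (simp only: mult_le_mono1 Suc_eq_plus1[symmetric] Suc_leI)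
    then have "{l * m + 1..(l + 1) * m} \<subseteq> {..k * m}"
      by auto
    ultimately show ?thesis
      using image(1) by blast
  qed
  moreover have "Ss ! j \<in> B ` {..k * m}" if "j \<le> k * m" for j
  proof (rule label_cases[OF m, of j])
    assume "j = 0"
    then show ?thesis
      using B0 by (metis atMost_iff image_eqI zero_le)
  next
    fix l r assume r: "r < m" "j = l * m + r + 1"
    have l: "l < k"
      using that unfolding r(2) label_le_iff[OF r(1)] .
    have "Ss ! j \<in> (!) Ss ` {l * m + 1..(l + 1) * m}"
      using r by (intro imageI) auto
    then obtain c where c: "c < m" "Ss ! j = scale (zeta m ^ c) (T l)"
      unfolding T[OF l] by blast
    then have "Ss ! j = B (l * m + c + 1)"
      using B by simp
    moreover have "l * m + c + 1 \<le> k * m"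
      using l label_le_iff[OF c(1)] by simp
    ultimately show ?thesis
      by blast
  qed
  ultimately have img: "B ` {..k * m} = \<sigma>"
    using image(1) by blast
  \<comment> \<open>Injectivity of \<open>B\<close> comes from counting: it maps
    \<open>k * m + 1\<close> indices onto equally many blocks.\<close>
  have card_\<sigma>: "card \<sigma> = Suc (k * m)"
    using card_image[OF image(2)] image(1) by simp
  then have inj: "inj_on B {..k * m}"
    using img by (intro eq_card_imp_inj_on) simp_all
  have equi: "B (rot m j d) = scale (zeta m ^ d) (B j)" if "j \<le> k * m" for j d
  proof (rule label_cases[OF m, of j])
    assume "j = 0"
    then show ?thesis
      using scale_zero_block[OF m P L] B0 by simp
  next
    fix l r assume r: "r < m" "j = l * m + r + 1"
    have "(r + d) mod m < m"
      using m by simp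
    then show ?thesis
      unfolding r(2) rot_label[OF r(1)] B[OF r(1)] by (simp only: B scale_scale scale_mod[OF m])
  qed
  have "zero_vec \<in> B 0"
    using L B0 by (simp add: labelling_def)
  then obtain v where v: "length v = Suc n" "v ! 0 = 0" "labels m v = {..k * m}"
      "\<And>j. j \<le> k * m \<Longrightarrow> B j = blk m v j"
    using equivariant_labelling[OF m P[folded img] inj _ equi] by blast
  then have \<sigma>: "\<sigma> = blk m v ` labels m v"
    using img by simp
  obtain k' w where w: "rg m k' w" "keq m v w"
    using keq_canonical[OF m _ v(2)] v(1) by (metis Zero_not_Suc list.size(3))
  have "\<sigma> = blk m w ` labels m w"
    unfolding \<sigma> by (rule keq_blk_image[OF m v(2) rgD(2)[OF w(1)] w(2)])
  moreover have labels: "labels m w = {..k' * m}"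
    by (rule labels_rg[OF m w(1)])
  ultimately have \<sigma>': "\<sigma> = blk m w ` {..k' * m}"
    by simp
  have "card \<sigma> = Suc (k' * m)"
    unfolding \<sigma>' using blk_inj[OF m rgD(2)[OF w(1)]] labels by (simp add: card_image)
  then have "k' = k"
    using card_\<sigma> m by simp
  moreover have "length w = Suc n"
    using w(2) v(1) by (simp add: keq_def)
  ultimately show thesis
    using that w(1) \<sigma>' by blast
qed

text \<open>No rearrangement is allowed here, so the list itself is shown to commute with rotation,
  using the color condition. Increasing least bases then give restricted growth. This is what makes
  the standard form unique.\<close>

lemma standard_form_imp_word:
  assumes m: "0 < m" and P: "partition_on (ground m n) \<sigma>" and S: "standard_form m n k \<sigma> Ss"
  obtains w where "rg m k w" "length w = Suc n" "Ss = map (blk m w) [0..<Suc (k * m)]"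
proof -
  have L: "labelling m n k \<sigma> Ss"
    and incr: "\<And>l. l < k \<Longrightarrow> minb m (Ss ! (l * m)) < minb m (Ss ! ((l + 1) * m))"
    and col: "\<And>j. 1 \<le> j \<Longrightarrow> j \<le> k * m \<Longrightarrow> colored m (minb m (Ss ! j)) (j mod m) \<in> Ss ! j"
    using S unfolding standard_form_def by auto
  obtain T where T: "\<And>l. l < k \<Longrightarrow>
      (!) Ss ` {l * m + 1..(l + 1) * m} = (\<lambda>c. scale (zeta m ^ c) (T l)) ` {..<m}"
    using labelling_groups[OF L] by blast
  note image = labelling_nth_image[OF L]
  have sub: "Ss ! j \<subseteq> ground m n" if "j \<le> k * m" for j
    using partition_onD1[OF P] image(1) that by blast
  have col': "minb m (Ss ! j) \<noteq> 0" "pt m (minb m (Ss ! j)) (j mod m) \<in> Ss ! j"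
    if "1 \<le> j" "j \<le> k * m" for j
    using colored_in_groundD[OF m] col[OF that] sub[OF that(2)] by (metis subsetD)+
  have grp: "\<exists>c. Ss ! j = scale (zeta m ^ c) (T l)" if "l < k" "r < m" "j = l * m + r + 1" for j l r
  proof -
    have "Ss ! j \<in> (!) Ss ` {l * m + 1..(l + 1) * m}"
      using that by (intro imageI) auto
    then show ?thesis
      unfolding T[OF that(1)] by blast
  qed
  have scale_mem: "scale (zeta m ^ c) (T l) \<in> \<sigma>" if "l < k" for c l
  proof -
    have "scale (zeta m ^ (c mod m)) (T l) \<in> (!) Ss ` {l * m + 1..(l + 1) * m}"
      unfolding T[OF that] using m by simp
    moreover have "(l + 1) * m \<le> k * m"
      using that by (simp only: mult_le_mono1 Suc_eq_plus1[symmetric] Suc_leI)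
    then have "{l * m + 1..(l + 1) * m} \<subseteq> {..k * m}"
      by auto
    ultimately show ?thesis
      using image(1) scale_mod[OF m] by fastforce
  qed
  have sub_T: "T l \<subseteq> ground m n" if "l < k" for l
  proof -
    have "scale (zeta m ^ 0) (T l) = T l"
      by (simp add: scale_def)
    then show ?thesis
      using scale_mem[OF that, of 0] partition_onD1[OF P] by auto
  qed
  have equi: "Ss ! rot m j d = scale (zeta m ^ d) (Ss ! j)" if j: "j \<le> k * m" for j d
  proof (rule label_cases[OF m, of j])
    assume "j = 0"
    then show ?thesis
      using scale_zero_block[OF m P L] by simp
  next
    fix l r assume r: "r < m" "j = l * m + r + 1"
    have l: "l < k"
      using j unfolding r(2) label_le_iff[OF r(1)] .
    define j' where "j' = rot m j d"
    have j': "j' = l * m + (r + d) mod m + 1"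
      unfolding j'_def r(2) by (rule rot_label[OF r(1)])
    have le: "j' \<le> k * m"
      unfolding j'_def using j by (simp only: rot_le_iff[OF m])
    obtain c where c: "Ss ! j = scale (zeta m ^ c) (T l)"
      using grp[OF l r] by blast
    have "(r + d) mod m < m"
      using m by simp
    then obtain c' where c': "Ss ! j' = scale (zeta m ^ c') (T l)"
      using grp[OF l _ j'] by blast
    have minb: "minb m (Ss ! j') = minb m (Ss ! j)"
      unfolding c c' by (simp only: minb_scale[OF m sub_T[OF l]])
    \<comment> \<open>Both \<open>j'\<close> and \<open>j + d\<close> have the same residue modulo
      \<open>m\<close>, so block \<open>j'\<close> and the rotation of block \<open>j\<close> by
      \<open>d\<close> share the colored least base; being blocks of one partition, they
      coincide.\<close>
    have "j mod m = (r + 1) mod m" "j' mod m = ((r + d) mod m + 1) mod m"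
      unfolding r(2) j' by (simp_all add: add.assoc del: add_Suc_right)
    then have "(j mod m + d) mod m = j' mod m mod m"
      by (simp add: mod_simps ac_simps)
    then have eq: "pt m (minb m (Ss ! j)) (j mod m + d) = pt m (minb m (Ss ! j')) (j' mod m)"
      unfolding minb by (simp add: pt_eq_iff[OF m])
    have ge: "1 \<le> j" "1 \<le> j'"
      using r(2) j' by simp_all
    have "pt m (minb m (Ss ! j)) (j mod m + d) \<in> scale (zeta m ^ d) (Ss ! j)"
      by (rule pt_in_scale[OF m col'(2)[OF ge(1) j]])
    moreover have "pt m (minb m (Ss ! j)) (j mod m + d) \<in> Ss ! j'"
      unfolding eq by (rule col'(2)[OF ge(2) le])
    moreover have "scale (zeta m ^ d) (Ss ! j) \<in> \<sigma>"
      unfolding c scale_scale by (rule scale_mem[OF l])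
    moreover have "Ss ! j' \<in> \<sigma>"
      using image(1) le by blast
    ultimately show ?thesis
      using disjointD[OF partition_onD2[OF P], of "Ss ! j'" "scale (zeta m ^ d) (Ss ! j)"]
      unfolding j'_def by blast
  qed
  have "zero_vec \<in> Ss ! 0"
    using L by (simp add: labelling_def)
  then obtain v where v: "length v = Suc n" "v ! 0 = 0" "labels m v = {..k * m}"
      and blk: "\<And>j. j \<le> k * m \<Longrightarrow> Ss ! j = blk m v j"
    using equivariant_labelling[OF m P[folded image(1)] image(2) _ equi] by blast
  note iff = pt_in_blk_iff[OF m v(2)]
  have mono: "minb m (Ss ! (Suc l * m)) \<le> minb m (Ss ! (Suc g * m))" if "l \<le> g" "g < k" for l g
    using that
  proof (induction g rule: dec_induct)
    case (step g)
    then show ?case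
      using incr[of "Suc g"] by simp
  qed simp
  have v_le: "v ! i \<le> k * m" if "i < length v" for i
    using labelsI[OF that, of m 0] v(3) m by simp
  have "rg m k v"
    unfolding rg_def
  proof (intro conjI allI impI)
    fix l assume l: "l < k"
    define s where "s = minb m (Ss ! (Suc l * m))"
    have le: "Suc l * m \<le> k * m" "1 \<le> Suc l * m"
      using l m by (simp_all only: mult_le_mono1 Suc_leI) simp
    have "pt m s 0 \<in> blk m v (Suc l * m)"
      using col'(2)[OF le(2,1)] blk[OF le(1)] by (simp add: s_def)
    then have s: "s < length v" "v ! s = Suc l * m"
      using m by (simp_all add: iff)
    have "v ! i \<le> l * m" if i: "i < s" for i
    proof (rule ccontr)
      assume gt: "\<not> v ! i \<le> l * m"
      have vi: "v ! i \<le> k * m"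
        using v_le i s(1) by simp
      show False
      proof (rule label_cases[OF m, of "v ! i"])
        fix g r assume r: "r < m" "v ! i = g * m + r + 1"
        have g: "l \<le> g" "g < k"
          using gt vi unfolding r(2) label_le_iff[OF r(1)] by simp_all
        \<comment> \<open>The amount \<open>m - 1 - r\<close> moves position \<open>r\<close> to the
          last label of group \<open>g\<close>, where least bases are known to increase.\<close>
        have "rot m (v ! i) (m - 1 - r) = g * m + (m - 1) + 1"
          unfolding r(2) rot_label[OF r(1)] using r(1) by simp
        then have "rot m (v ! i) (m - 1 - r) = Suc g * m"
          using m by simp
        then have "minb m (Ss ! (Suc g * m)) = minb m (Ss ! (v ! i))"
          using equi[OF vi, of "m - 1 - r"] minb_scale[OF m sub[OF vi]] by simp
        also have "\<dots> \<le> i"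
        proof -
          have "pt m i 0 \<in> Ss ! (v ! i)"
            unfolding blk[OF vi] using i s(1) m by (simp add: iff)
          then show ?thesis
            unfolding minb_eq[OF m sub[OF vi]] by (intro Least_le exI)
        qed
        also have "\<dots> < s"
          by (rule i)
        finally show False
          using mono[OF g] by (simp add: s_def)
      qed (use gt in simp)
    qed
    with s show "\<exists>i<length v. v ! i = Suc l * m \<and> (\<forall>i'<i. v ! i' \<le> l * m)"
      by blast
  qed (use v v_le in auto)
  moreover have "Ss = map (blk m v) [0..<Suc (k * m)]"
    using L blk by (intro nth_equalityI) (simp_all add: labelling_def nth_map_upt del: upt_Suc)
  ultimately show thesis
    using that v(1) by blast
qed


section \<open>The recurrence\<close>

definition words :: "nat \<Rightarrow> nat \<Rightarrow> nat \<Rightarrow> nat list set" where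
  "words m n k = {w. length w = Suc n \<and> rg m k w}"

lemma finite_words: "finite (words m n k)"
proof (rule finite_subset)
  show "words m n k \<subseteq> {w. set w \<subseteq> {..k * m} \<and> length w = Suc n}"
    using rgD(3) by (auto simp: words_def in_set_conv_nth)
qed (simp add: finite_lists_length_eq)

lemma blk_image_unique:
  assumes "0 < m" "w \<in> words m n k" "w' \<in> words m n k" "blk m w ` {..k * m} = blk m w' ` {..k * m}"
  shows "w = w'"
proof -
  have w: "rg m k w" "rg m k w'" "length w = length w'"
    using assms by (simp_all add: words_def)
  have "keq m w w'"
    using assms(4) labels_rg[OF assms(1) w(1)] labels_rg[OF assms(1) w(2)]
    by (intro blk_image_keq[OF assms(1) rgD(2)[OF w(1)] rgD(2)[OF w(2)] w(3)]) simp
  then show ?thesis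
    by (rule keq_rg_unique[OF assms(1) w(1,2)])
qed

text \<open>Existence of a labelling makes the map from words to partitions onto, and the kernel
  makes it injective. Uniqueness of the standard form identifies the list of blocks on which
  inversions are counted.\<close>

lemma S_CR_words:
  assumes m: "0 < m"
  shows "S_CR m n k = (\<Sum>w\<in>words m n k. q ^ winv w)"
proof -
  let ?f = "\<lambda>w. blk m w ` {..k * m}"
  have part: "partition_on (ground m n) (?f w)" if "w \<in> words m n k" for w
    using blk_partition[OF m, of w n] rgD(2)[of m k w] labels_rg[OF m, of k w] that
    by (simp add: words_def)
  have std: "standard_form m n k (?f w) (map (blk m w) [0..<Suc (k * m)])" if "w \<in> words m n k" for w
    using standard_form_word[OF m, of k w n] that by (simp add: words_def)
  have "inj_on ?f (words m n k)"
    using blk_image_unique[OF m] by (intro inj_onI)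
  moreover have "?f ` words m n k = colored_partitions m n k"
  proof (intro equalityI subsetI)
    fix \<sigma> assume "\<sigma> \<in> ?f ` words m n k"
    then show "\<sigma> \<in> colored_partitions m n k"
      using part std unfolding colored_partitions_def standard_form_def by blast
  next
    fix \<sigma> assume "\<sigma> \<in> colored_partitions m n k"
    then obtain Ss where "partition_on (ground m n) \<sigma>" "labelling m n k \<sigma> Ss"
      by (auto simp: colored_partitions_def)
    then obtain w where "rg m k w" "length w = Suc n" "\<sigma> = ?f w"
      using labelling_word[OF m] by blast
    then show "\<sigma> \<in> ?f ` words m n k"
      by (simp add: words_def)
  qed
  ultimately have bij: "bij_betw ?f (words m n k) (colored_partitions m n k)"
    by (simp add: bij_betw_def)
  have stat: "inv_stat m n k (?f w) = winv w" if w: "w \<in> words m n k" for w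
  proof -
    have "the_standard_form m n k (?f w) = map (blk m w) [0..<Suc (k * m)]"
      unfolding the_standard_form_def
    proof (rule the_equality)
      show "standard_form m n k (?f w) (map (blk m w) [0..<Suc (k * m)])"
        by (rule std[OF w])
      fix Ss assume Ss: "standard_form m n k (?f w) Ss"
      obtain w' where w': "rg m k w'" "length w' = Suc n" "Ss = map (blk m w') [0..<Suc (k * m)]"
        using standard_form_imp_word[OF m part[OF w] Ss] by blast
      have "set Ss = ?f w"
        using Ss by (simp add: standard_form_def labelling_def)
      then have "?f w' = ?f w"
        using w'(3) by (simp add: atLeast0LessThan lessThan_Suc_atMost del: upt_Suc)
      then have "w' = w"
        using blk_image_unique[OF m _ w] w' by (simp add: words_def)
      with w'(3) show "Ss = map (blk m w) [0..<Suc (k * m)]"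
        by simp
    qed
    then show ?thesis
      unfolding inv_stat_def using card_inversions[OF m, of k w n] w by (simp add: words_def)
  qed
  have "S_CR m n k = (\<Sum>w\<in>words m n k. q ^ inv_stat m n k (?f w))"
    unfolding S_CR_def by (rule sum.reindex_bij_betw[OF bij, symmetric])
  also have "\<dots> = (\<Sum>w\<in>words m n k. q ^ winv w)"
    by (intro sum.cong) (simp_all add: stat)
  finally show ?thesis .
qed

text \<open>The largest letter of \<open>w\<close> is exactly \<open>k * m\<close>, so the new
  position is inverted with the labels above \<open>j\<close> up to \<open>k * m\<close>. For an
  opening letter the truncated difference is 0.\<close>

lemma winv_snoc:
  assumes "0 < m" "rg m k w"
  shows "winv (w @ [j]) = winv w + (k * m - j)"
proof -
  define X where "X = {(i, l). i < length w \<and> w ! i < l \<and> (\<exists>i'\<le>i. l \<le> w ! i')}"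
  have "\<exists>i'<length w. w ! i' = k * m"
  proof (cases k)
    case 0
    then show ?thesis
      using rgD(1,2)[OF assms(2)] by (intro exI[of _ 0]) simp
  next
    case (Suc l)
    then show ?thesis
      using rgD(4)[OF assms(2), of l] by auto
  qed
  then have ex: "(\<exists>i'<length w. l \<le> w ! i') \<longleftrightarrow> l \<le> k * m" for l
    using rgD(3)[OF assms(2)] by (metis order_trans order_refl)
  have "{(i, l). i < length (w @ [j]) \<and> (w @ [j]) ! i < l \<and> (\<exists>i'\<le>i. l \<le> (w @ [j]) ! i')}
      = X \<union> {length w} \<times> {j<..k * m}"
  proof -
    have "(\<exists>i'\<le>i. l \<le> (w @ [j]) ! i') \<longleftrightarrow> (\<exists>i'\<le>i. l \<le> w ! i')" if "i < length w" for i l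
      using that by (metis le_less_trans nth_append)
    \<comment> \<open>As \<open>j < l\<close>, the new letter cannot itself be the witness.\<close>
    moreover have "(\<exists>i'\<le>length w. l \<le> (w @ [j]) ! i') \<longleftrightarrow> l \<le> k * m" if "j < l" for l
    proof -
      have "(\<exists>i'\<le>length w. l \<le> (w @ [j]) ! i') \<longleftrightarrow> (\<exists>i'<length w. l \<le> w ! i')"
        using that by (metis le_less leD nth_append nth_append_length)
      with ex show ?thesis by simp
    qed
    moreover have "(w @ [j]) ! i = w ! i" if "i < length w" for i
      using that by (simp add: nth_append)
    ultimately have "i < length (w @ [j]) \<and> (w @ [j]) ! i < l \<and> (\<exists>i'\<le>i. l \<le> (w @ [j]) ! i') \<longleftrightarrow>
        (i, l) \<in> X \<union> {length w} \<times> {j<..k * m}" for i l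
      unfolding X_def by (cases i "length w" rule: linorder_cases) auto
    then show ?thesis
      by blast
  qed
  moreover have "finite X"
  proof (rule finite_subset)
    show "X \<subseteq> {..<length w} \<times> {..k * m}"
      using rgD(3)[OF assms(2)] unfolding X_def by (auto intro: order_trans dest: le_less_trans)
  qed simp
  moreover have "X \<inter> {length w} \<times> {j<..k * m} = {}"
    by (auto simp: X_def)
  ultimately show ?thesis
    unfolding winv_def X_def[symmetric] by (simp add: card_Un_disjoint card_cartesian_product)
qed

section \<open>Geometric sums and the weight of an appended letter\<close>

lemma qnum_Suc: "qnum (Suc n) = qnum n + q ^ n"
  by (simp add: qnum_def)

lemma qnum_add: "qnum (a + b) = qnum a + q ^ a * qnum b"
  by (induction b) (simp_all add: qnum_Suc algebra_simps power_add, simp add: qnum_def)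

lemma qnum_rev: "(\<Sum>j\<le>n. q ^ (n - j)) = qnum (Suc n)"
  unfolding qnum_def lessThan_Suc_atMost[symmetric]
  using sum.nat_diff_reindex[of "\<lambda>i. q ^ i" "Suc n"] by simp

lemma sum_words_snoc:
  assumes "0 < m"
  shows "(\<Sum>w\<in>(\<lambda>(w, j). w @ [j]) ` (words m n k \<times> {..k * m}). q ^ winv w) =
    qnum (k * m + 1) * (\<Sum>w\<in>words m n k. q ^ winv w)"
proof -
  have winv: "q ^ winv (w @ [j]) = q ^ winv w * q ^ (k * m - j)" if "w \<in> words m n k" for w j
    using that winv_snoc[OF assms, of k w j] by (simp only: words_def mem_Collect_eq power_add)
  have "(\<Sum>w\<in>(\<lambda>(w, j). w @ [j]) ` (words m n k \<times> {..k * m}). q ^ winv w) =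
      (\<Sum>(w, j)\<in>words m n k \<times> {..k * m}. q ^ winv (w @ [j]))"
    by (subst sum.reindex) (auto simp: inj_on_def intro!: sum.cong)
  also have "\<dots> = (\<Sum>(w, j)\<in>words m n k \<times> {..k * m}. q ^ winv w * q ^ (k * m - j))"
    using winv by (intro sum.cong refl) (simp only: mem_Sigma_iff split_paired_all prod.case)
  also have "\<dots> = (\<Sum>w\<in>words m n k. q ^ winv w * qnum (Suc (k * m)))"
    by (simp only: sum.cartesian_product[symmetric] sum_distrib_left[symmetric] qnum_rev)
  finally show ?thesis
    by (simp add: sum_distrib_left mult.commute)
qed

lemma snoc_in_words_iff:
  assumes "0 < m"
  shows "u @ [j] \<in> words m (Suc n) k \<longleftrightarrow>
    u \<in> words m n k \<and> j \<le> k * m \<or> (\<exists>k'. k = Suc k' \<and> u \<in> words m n k' \<and> j = k * m)"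
  using rg_snoc[OF assms, of u k j] by (cases "u = []") (auto simp: words_def)

lemma words_Suc:
  assumes "0 < m"
  shows "words m (Suc n) k = (\<lambda>(w, j). w @ [j]) ` (words m n k \<times> {..k * m}) \<union>
    (case k of 0 \<Rightarrow> {} | Suc k' \<Rightarrow> (\<lambda>w. w @ [k * m]) ` words m n k')" (is "_ = ?R")
proof (rule set_eqI)
  fix w
  show "w \<in> words m (Suc n) k \<longleftrightarrow> w \<in> ?R"
  proof (cases w rule: rev_cases)
    case Nil
    then show ?thesis
      by (auto simp: words_def split: nat.splits)
  next
    case (snoc u j)
    then show ?thesis
      unfolding snoc snoc_in_words_iff[OF assms] by (auto split: nat.splits)
  qed
qed

lemma S_CR_Suc_0:
  assumes "0 < m"
  shows "S_CR m (Suc n) 0 = S_CR m n 0"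
proof -
  have "words m (Suc n) 0 = (\<lambda>(w, j). w @ [j]) ` (words m n 0 \<times> {..0 * m})"
    using words_Suc[OF assms, of n 0] by simp
  then show ?thesis
    using sum_words_snoc[OF assms, of n 0] by (simp add: S_CR_words[OF assms] qnum_def)
qed

lemma S_CR_Suc_Suc:
  assumes "0 < m"
  shows "S_CR m (Suc n) (Suc k) = S_CR m n k + qnum (Suc k * m + 1) * S_CR m n (Suc k)"
proof -
  let ?A = "(\<lambda>(w, j). w @ [j]) ` (words m n (Suc k) \<times> {..Suc k * m})"
  let ?B = "(\<lambda>w. w @ [Suc k * m]) ` words m n k"
  have "words m (Suc n) (Suc k) = ?A \<union> ?B"
    using words_Suc[OF assms, of n "Suc k"] by simp
  \<comment> \<open>Both sets contain words ending in \<open>Suc k * m\<close>, but the prefixes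
    have opened different numbers of groups.\<close>
  moreover have "?A \<inter> ?B = {}"
    using rg_unique_size[OF assms, of "Suc k" _ k] by (auto simp: words_def)
  ultimately have "S_CR m (Suc n) (Suc k) = (\<Sum>w\<in>?A. q ^ winv w) + (\<Sum>w\<in>?B. q ^ winv w)"
    unfolding S_CR_words[OF assms] using finite_words by (simp only:) (intro sum.union_disjoint, auto)
  also have "(\<Sum>w\<in>?A. q ^ winv w) = qnum (Suc k * m + 1) * S_CR m n (Suc k)"
    unfolding S_CR_words[OF assms] by (rule sum_words_snoc[OF assms])
  also have "(\<Sum>w\<in>?B. q ^ winv w) = S_CR m n k"
    unfolding S_CR_words[OF assms]
    by (subst sum.reindex) (auto simp: inj_on_def words_def winv_snoc[OF assms] intro!: sum.cong)
  finally show ?thesis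
    by (simp add: add.commute)
qed

lemma words_0: "0 < m \<Longrightarrow> words m 0 k = (if k = 0 then {[0]} else {})"
  by (auto simp: words_def length_Suc_conv rg_singleton)

lemma winv_singleton: "winv [a] = 0"
proof -
  have "{(i, l). i < length [a] \<and> [a] ! i < l \<and> (\<exists>i'\<le>i. l \<le> [a] ! i')} = {}"
    by auto
  then show ?thesis
    unfolding winv_def by (simp only: card.empty)
qed

lemma S_CR_0_0: "0 < m \<Longrightarrow> S_CR m 0 0 = 1"
  by (simp add: S_CR_words words_0 winv_singleton)


section \<open>The alternating sum\<close>

lemma So_CR_Suc:
  assumes "0 < m"
  shows "So_CR m (Suc n) k =
    (case k of 0 \<Rightarrow> 0 | Suc k' \<Rightarrow> qnum (k * m) * So_CR m n k') + qnum (k * m + 1) * So_CR m n k"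
proof (cases k)
  case 0
  then show ?thesis
    by (simp add: So_CR_def S_CR_Suc_0[OF assms] qnum_def)
next
  case (Suc k')
  have "qfact_step m (Suc k') = qfact_step m k' * qnum (Suc k' * m)"
    by (simp add: qfact_step_def)
  then show ?thesis
    unfolding Suc So_CR_def S_CR_Suc_Suc[OF assms] by (simp add: algebra_simps)
qed

text \<open>By the recurrence each \<open>So_CR m n k\<close> feeds the indices \<open>k + 1\<close>
  and \<open>k\<close>; the combined coefficient does not depend on \<open>k\<close>, so it factors
  out of the sum.\<close>

lemma alternating_sum_So_CR:
  assumes m: "0 < m"
  shows "(\<Sum>k\<le>n. (- (q ^ (m - 1))) ^ (n - k) * So_CR m n k) = qnum (m - 1) ^ n"
proof (induction n)
  case 0
  then show ?case
    by (simp add: So_CR_def qfact_step_def S_CR_0_0[OF m])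
next
  case (Suc n)
  define x where "x = - (q ^ (m - 1))"
  let ?S = "So_CR m n"
  let ?A = "\<lambda>k. case k of 0 \<Rightarrow> 0 | Suc k' \<Rightarrow> qnum (k * m) * ?S k'"
  have key: "qnum (Suc k * m) + x * qnum (k * m + 1) = qnum (m - 1)" for k
  proof -
    \<comment> \<open>This splitting is the origin of the constant \<open>q ^ (m - 1)\<close>: it
      makes the two q-numbers cancel up to \<open>qnum (m - 1)\<close>.\<close>
    have "Suc k * m = (m - 1) + (k * m + 1)"
      using m by simp
    then have "qnum (Suc k * m) = qnum (m - 1) + q ^ (m - 1) * qnum (k * m + 1)"
      by (metis qnum_add)
    then show ?thesis
      unfolding x_def by (simp del: mult_Suc)
  qed
  have "(\<Sum>k\<le>Suc n. x ^ (Suc n - k) * So_CR m (Suc n) k) =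
      (\<Sum>k\<le>Suc n. x ^ (Suc n - k) * ?A k) + (\<Sum>k\<le>Suc n. x ^ (Suc n - k) * (qnum (k * m + 1) * ?S k))"
    by (simp only: So_CR_Suc[OF m] distrib_left sum.distrib)
  also have "(\<Sum>k\<le>Suc n. x ^ (Suc n - k) * ?A k) = (\<Sum>k\<le>n. x ^ (n - k) * (qnum (Suc k * m) * ?S k))"
    by (subst sum.atMost_Suc_shift) simp
  \<comment> \<open>The term at \<open>Suc n\<close> vanishes; for \<open>k \<le> n\<close> the
    exponent \<open>Suc n - k\<close> leaves one spare factor \<open>x\<close>.\<close>
  also have "(\<Sum>k\<le>Suc n. x ^ (Suc n - k) * (qnum (k * m + 1) * ?S k)) =
      (\<Sum>k\<le>n. x ^ (n - k) * (x * qnum (k * m + 1) * ?S k))"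
    using m by (simp add: So_CR_eq_0 Suc_diff_le mult_ac)
  also have "(\<Sum>k\<le>n. x ^ (n - k) * (qnum (Suc k * m) * ?S k)) + \<dots> =
      (\<Sum>k\<le>n. x ^ (n - k) * ((qnum (Suc k * m) + x * qnum (k * m + 1)) * ?S k))"
    by (simp only: sum.distrib[symmetric] distrib_left distrib_right)
  also have "\<dots> = qnum (m - 1) * (\<Sum>k\<le>n. x ^ (n - k) * ?S k)"
    unfolding key by (simp add: sum_distrib_left mult_ac)
  also have "\<dots> = qnum (m - 1) ^ Suc n"
    using Suc by (simp add: x_def)
  finally show ?case
    by (simp add: x_def)
qed

theorem theorem4p12:
  fixes m n :: nat
  assumes "m \<ge> 1"
  shows "Sum_any (\<lambda>k. (- (q ^ (m - 1))) ^ (n - k) * So_CR m n k) = qnum (m - 1) ^ n"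
proof -
  have "Sum_any (\<lambda>k. (- (q ^ (m - 1))) ^ (n - k) * So_CR m n k) =
      (\<Sum>k\<le>n. (- (q ^ (m - 1))) ^ (n - k) * So_CR m n k)"
  \<comment> \<open>Beyond \<open>n\<close> the truncated exponent is 0 and the power is 1, so the
    vanishing must come from \<open>So_CR\<close>.\<close>
  proof (rule Sum_any.expand_superset)
    show "{k. (- (q ^ (m - 1))) ^ (n - k) * So_CR m n k \<noteq> 0} \<subseteq> {..n}"
      using So_CR_eq_0[OF assms] by (auto simp: not_less[symmetric])
  qed simp
  then show ?thesis
    using alternating_sum_So_CR[of m n] assms by simp
qed

end
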